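(* Consider the mean-field sharing model with multiple types (MF-T model) and its coordinated system, with $\mathcal{G}_{\mathit{MF-T}}$, $J$, $\hat\ell_t$ and the conditional expectations given $(Z_t,\tilde\Gamma_t)$ as described in the context. Within the control strategies $\mathcal{G}_{\mathit{MF-T}}$, there is no loss of optimality in restricting attention to Markovian strategies, i.e. strategies of the form $U^i_t=g_t(\theta^i,Z_t,X^i_t)$. Furthermore, an optimal strategy $(\mathbf g(1)^\ast,\ldots,\mathbf g(k)^\ast)$, i.e. one minimizing $J$ over $\mathcal{G}_{\mathit{MF-T}}$, is obtained by solving the following dynamic program. Define recursively value functions $V_{T+1}(z):=0$ for all $z$, and for $t=T,\ldots,1$, $$V_t(z_t):=\min_{\tilde\gamma_t}\Big(\hat\ell_t(z_t,\tilde\gamma_t)+\mathbb{E}\big[V_{t+1}(Z_{t+1})\,\big|\,Z_t=z_t,\tilde\Gamma_t=\tilde\gamma_t\big]\Big),$$ where the minimum is over $\tilde\gamma_t=(\gamma_t(1),\ldots,\gamma_t(k))$ with $\gamma_t(\theta):\mathcal{X}(\theta)\to\mathcal{U}(\theta)$ for every $\theta\in\Theta$. Let $\psi^\ast_t(z_t)$ denote an argmin of the right-hand side. Define $g^\ast_t(\theta,z,x):=\psi^\ast_t(z)(\theta,x)$ for all $\theta,x,z$. Then the collection of strategies $\mathbf g(\theta)^\ast=(g^\ast_1(\theta,\cdot),\ldots,g^\ast_T(\theta,\cdot))$, $\theta\in\Theta$, is optimal.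
   Context: MF-T model. Let $n,k,T\in\mathbb{N}$ and $\Theta=\{1,\ldots,k\}$ (set of types). Subsystem $i\in\{1,\ldots,n\}$ has a fixed type $\theta^i\in\Theta$, known a priori to every subsystem. For each $\theta\in\Theta$, $\mathcal{X}(\theta)$ and $\mathcal{U}(\theta)$ are finite sets. At time $t$, subsystem $i$ has state $X^i_t\in\mathcal{X}(\theta^i)$ and control action $U^i_t\in\mathcal{U}(\theta^i)$; write $\mathbf X_t=(X^1_t,\ldots,X^n_t)$, $\mathbf U_t=(U^1_t,\ldots,U^n_t)$. The mean-field is the empirical distribution $Z_t=\frac1n\sum_{i=1}^n\delta_{(\theta^i,X^i_t)}$ on $\tilde{\mathcal X}=\bigcup_{\theta\in\Theta}\{\theta\}\times\mathcal{X}(\theta)$, where $\delta$ denotes a Dirac measure; $z$ ranges over the finite set of possible values of such empirical distributions. Dynamics: $X^i_{t+1}=f_t(\theta^i,Z_t,X^i_t,U^i_t,W^i_t)$. The primitive random variables $X^1_1,\ldots,X^n_1$ and $W^i_t$ ($1\le i\le n$, $1\le t\le T$) are mutually independent. The dynamics $f_t$ and the distributions of $X^i_1$ and $W^i_t$ may depend on the type $\theta^i$ but not otherwise on $i$ (so subsystems of the same type have the same dynamics and identically distributed primitive variables). Control: all controllers of the same type use the same control law, $U^i_t=g_t(\theta^i,Z_{1:t},X^i_t)$, where $Z_{1:t}=(Z_1,\ldots,Z_t)$. A control strategy is a collection $(\mathbf g(1),\ldots,\mathbf g(k))$ with $\mathbf g(\theta)=(g_1(\theta,\cdot),\ldots,g_T(\theta,\cdot))$;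 $\mathcal{G}_{\mathit{MF-T}}$ is the set of all such strategies. At time $t$ the system incurs a cost $\ell_t(\mathbf X_t,\mathbf U_t)\in\mathbb{R}$, with $\ell_t$ an arbitrary function. The expected total cost is $J(\mathbf g(1),\ldots,\mathbf g(k))=\mathbb{E}\big[\sum_{t=1}^T\ell_t(\mathbf X_t,\mathbf U_t)\big]$, the expectation being with respect to the measure induced by the strategy. Coordinated system. A coordinator observes $Z_{1:t}$ and chooses a prescription $\tilde\Gamma_t=\tilde\psi_t(Z_{1:t})$, where a prescription is a function $\tilde\gamma$ on $\tilde{\mathcal X}$ with $\tilde\gamma(\theta,x)\in\mathcal{U}(\theta)$, equivalently a tuple $(\gamma(1),\ldots,\gamma(k))$ of maps $\gamma(\theta):\mathcal{X}(\theta)\to\mathcal{U}(\theta)$ with $\tilde\gamma(\theta,x)=\gamma(\theta)(x)$. Actions are generated by $U^i_t=\tilde\Gamma_t(\theta^i,X^i_t)$; the dynamics are $X^i_{t+1}=f_t(\theta^i,Z_t,X^i_t,U^i_t,W^i_t)$ for $i\in\{1,\ldots,n\}$, with the same primitive random variables, and the cost incurred at time $t$ is $\ell_t(\mathbf X_t,\mathbf U_t)$. The sequence $\tilde{\boldsymbol\psi}=(\tilde\psi_1,\ldots,\tilde\psi_T)$ is a coordination strategy. The function $\hat\ell_t$ is the one satisfying $\mathbb{E}[\ell_t(\mathbf X_t,\mathbf U_t)\mid Z_{1:t},\tilde\Gamma_{1:t}]=\hat\ell_t(Z_t,\tilde\Gamma_t)$ in the coordinated system under every coordination strategy; thus $\hat\ell_t(z,\tilde\gamma)=\mathbb{E}[\ell_t(\mathbf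 X_t,\mathbf U_t)\mid Z_t=z,\tilde\Gamma_t=\tilde\gamma]$. Conditional expectations given $\{Z_t=z,\tilde\Gamma_t=\tilde\gamma\}$ are taken in the coordinated system under any coordination strategy giving this event positive probability (the values do not depend on the choice); if no coordination strategy gives it positive probability, $\hat\ell_t(z,\tilde\gamma)$ is any fixed real number and the conditional law of $Z_{t+1}$ is any fixed probability distribution on the set of possible mean-fields. *)

theory Defs
  imports "HOL-Probability.Probability"
begin

text \<open>
  Subsystems are \<open>1, ..., nsub\<close>, types are \<open>1, ..., ntyp\<close>, times are \<open>1, ..., horizon\<close>.
  State and action profiles are extensional functions on the set of subsystems, so that the
  arbitrary cost function sees exactly the actual states and actions.
\<close>

type_synonym 'x mean_field = "(nat \<times> 'x) pmf"

type_synonym ('x, 'u) prescription = "nat \<times> 'x \<Rightarrow> 'u"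

text \<open>
  Arguments of a control strategy: time, type, observed history \<open>[Z 1, ..., Z t]\<close>, local state.
  Arguments of a coordination strategy: time, observed history \<open>[Z 1, ..., Z t]\<close>.
\<close>

type_synonym ('x, 'u) strategy = "nat \<Rightarrow> nat \<Rightarrow> 'x mean_field list \<Rightarrow> 'x \<Rightarrow> 'u"

type_synonym ('x, 'u) coord_strategy = "nat \<Rightarrow> 'x mean_field list \<Rightarrow> ('x, 'u) prescription"

text \<open>
  Arguments: \<open>noise_space t \<theta>\<close>, \<open>init i \<omega>\<close>, \<open>noise i t \<omega>\<close>, \<open>dyn t \<theta> z x u w\<close>,
  \<open>cost t x u\<close>, where in \<open>cost\<close> the variables \<open>x\<close>, \<open>u\<close> are profiles.  The noise may take
  values in an arbitrary measurable space.
\<close>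

record ('x, 'u, 'w, 'a) mft =
  nsub :: nat
  ntyp :: nat
  horizon :: nat
  type_of :: "nat \<Rightarrow> nat"
  state_set :: "nat \<Rightarrow> 'x set"
  action_set :: "nat \<Rightarrow> 'u set"
  noise_space :: "nat \<Rightarrow> nat \<Rightarrow> 'w measure"
  base :: "'a measure"
  init :: "nat \<Rightarrow> 'a \<Rightarrow> 'x"
  noise :: "nat \<Rightarrow> nat \<Rightarrow> 'a \<Rightarrow> 'w"
  dyn :: "nat \<Rightarrow> nat \<Rightarrow> 'x mean_field \<Rightarrow> 'x \<Rightarrow> 'u \<Rightarrow> 'w \<Rightarrow> 'x"
  cost :: "nat \<Rightarrow> (nat \<Rightarrow> 'x) \<Rightarrow> (nat \<Rightarrow> 'u) \<Rightarrow> real"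

definition state_profiles :: "('x, 'u, 'w, 'a) mft \<Rightarrow> (nat \<Rightarrow> 'x) set" where
  "state_profiles M = (\<Pi>\<^sub>E i\<in>{1..nsub M}. state_set M (type_of M i))"

text \<open>The image of the uniform distribution on the subsystems is \<open>1/n\<close> times the sum of the
  Dirac measures at \<open>(type_of M i, x i)\<close>.\<close>

definition empirical :: "('x, 'u, 'w, 'a) mft \<Rightarrow> (nat \<Rightarrow> 'x) \<Rightarrow> 'x mean_field" where
  "empirical M x = map_pmf (\<lambda>i. (type_of M i, x i)) (pmf_of_set {1..nsub M})"

definition mean_fields :: "('x, 'u, 'w, 'a) mft \<Rightarrow> 'x mean_field set" where
  "mean_fields M = empirical M ` state_profiles M"

definition mf_histories :: "('x, 'u, 'w, 'a) mft \<Rightarrow> nat \<Rightarrow> 'x mean_field list set" where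
  "mf_histories M t = {zs. length zs = t \<and> set zs \<subseteq> mean_fields M}"

text \<open>
  Mutual independence of the primitive variables is stated with \<open>indep_sets\<close> because
  \<open>indep_vars\<close> needs a common value type for the initial states and the noise; this is what
  \<open>indep_vars\<close> unfolds to.
\<close>

definition primitive_events :: "('x, 'u, 'w, 'a) mft \<Rightarrow> nat + nat \<times> nat \<Rightarrow> 'a set set" where
  "primitive_events M j = (case j of
      Inl i \<Rightarrow> {init M i -` A \<inter> space (base M) | A.
        A \<in> sets (count_space (state_set M (type_of M i)))}
    | Inr (i, t) \<Rightarrow> {noise M i t -` A \<inter> space (base M) | A.
        A \<in> sets (noise_space M t (type_of M i))})"

text \<open>
  Assumption \<open>actions_nonempty\<close> only says that prescriptions (equivalently, strategies) exist.
\<close>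

locale mft_model = prob_space "base M" for M :: "('x, 'u, 'w, 'a) mft" +
  assumes nsub_pos: "1 \<le> nsub M"
    and types: "\<And>i. i \<in> {1..nsub M} \<Longrightarrow> type_of M i \<in> {1..ntyp M}"
    and finite_states: "\<And>\<theta>. \<theta> \<in> {1..ntyp M} \<Longrightarrow> finite (state_set M \<theta>)"
    and finite_actions: "\<And>\<theta>. \<theta> \<in> {1..ntyp M} \<Longrightarrow> finite (action_set M \<theta>)"
    and actions_nonempty:
      "\<And>\<theta>. \<theta> \<in> {1..ntyp M} \<Longrightarrow> state_set M \<theta> \<noteq> {} \<Longrightarrow> action_set M \<theta> \<noteq> {}"
    and init_rv:
      "\<And>i. i \<in> {1..nsub M} \<Longrightarrow> init M i \<in> base M \<rightarrow>\<^sub>M count_space (state_set M (type_of M i))"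
    and noise_rv:
      "\<And>i t. i \<in> {1..nsub M} \<Longrightarrow> t \<in> {1..horizon M} \<Longrightarrow>
        noise M i t \<in> base M \<rightarrow>\<^sub>M noise_space M t (type_of M i)"
    and independent:
      "indep_sets (primitive_events M) ({1..nsub M} <+> {1..nsub M} \<times> {1..horizon M})"
    and init_ident:
      "\<And>i j. i \<in> {1..nsub M} \<Longrightarrow> j \<in> {1..nsub M} \<Longrightarrow> type_of M i = type_of M j \<Longrightarrow>
        distr (base M) (count_space (state_set M (type_of M i))) (init M i) =
        distr (base M) (count_space (state_set M (type_of M j))) (init M j)"
    and noise_ident:
      "\<And>i j t. i \<in> {1..nsub M} \<Longrightarrow> j \<in> {1..nsub M} \<Longrightarrow> t \<in> {1..horizon M} \<Longrightarrow>
        type_of M i = type_of M j \<Longrightarrow>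
        distr (base M) (noise_space M t (type_of M i)) (noise M i t) =
        distr (base M) (noise_space M t (type_of M j)) (noise M j t)"
    and dyn_measurable:
      "\<And>t \<theta> z x u. t \<in> {1..horizon M} \<Longrightarrow> \<theta> \<in> {1..ntyp M} \<Longrightarrow> z \<in> mean_fields M \<Longrightarrow>
        x \<in> state_set M \<theta> \<Longrightarrow> u \<in> action_set M \<theta> \<Longrightarrow>
        dyn M t \<theta> z x u \<in> noise_space M t \<theta> \<rightarrow>\<^sub>M count_space (state_set M \<theta>)"

definition prescriptions :: "('x, 'u, 'w, 'a) mft \<Rightarrow> ('x, 'u) prescription set" where
  "prescriptions M =
    (\<Pi>\<^sub>E p\<in>(SIGMA \<theta>:{1..ntyp M}. state_set M \<theta>). action_set M (fst p))"

definition coord_strategies :: "('x, 'u, 'w, 'a) mft \<Rightarrow> ('x, 'u) coord_strategy set" where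
  "coord_strategies M =
    {\<psi>. \<forall>t\<in>{1..horizon M}. \<forall>zs\<in>mf_histories M t. \<psi> t zs \<in> prescriptions M}"

definition strategies :: "('x, 'u, 'w, 'a) mft \<Rightarrow> ('x, 'u) strategy set" where
  "strategies M =
    {g. \<forall>t\<in>{1..horizon M}. \<forall>\<theta>\<in>{1..ntyp M}. \<forall>zs\<in>mf_histories M t. \<forall>x\<in>state_set M \<theta>.
          g t \<theta> zs x \<in> action_set M \<theta>}"

definition markov_strategies :: "('x, 'u, 'w, 'a) mft \<Rightarrow> ('x, 'u) strategy set" where
  "markov_strategies M =
    {g \<in> strategies M. \<exists>h. \<forall>t\<in>{1..horizon M}. \<forall>\<theta>\<in>{1..ntyp M}. \<forall>zs\<in>mf_histories M t.
          \<forall>x\<in>state_set M \<theta>. g t \<theta> zs x = h t \<theta> (last zs) x}"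

definition actions_of ::
  "('x, 'u, 'w, 'a) mft \<Rightarrow> ('x, 'u) prescription \<Rightarrow> (nat \<Rightarrow> 'x) \<Rightarrow> nat \<Rightarrow> 'u" where
  "actions_of M \<gamma> x = (\<lambda>i\<in>{1..nsub M}. \<gamma> (type_of M i, x i))"

text \<open>
  The pair of the state profile and the history \<open>[Z 1, ..., Z t]\<close> at time \<open>t\<close> when the actions
  are \<open>d t [Z 1, ..., Z t] (type_of M i, x i)\<close>.  For a coordination strategy \<open>d\<close> this is the
  coordinated system; a control strategy \<open>g\<close> is run through \<open>decision_rule g\<close> below.  Time starts
  at 1; the value at time 0 is left unspecified.
\<close>

fun trajectory ::
  "('x, 'u, 'w, 'a) mft \<Rightarrow> ('x, 'u) coord_strategy \<Rightarrow> 'a \<Rightarrow> nat \<Rightarrow>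
    (nat \<Rightarrow> 'x) \<times> 'x mean_field list" where
  "trajectory M d \<omega> (Suc 0) =
    (let x = (\<lambda>i\<in>{1..nsub M}. init M i \<omega>) in (x, [empirical M x]))"
| "trajectory M d \<omega> (Suc (Suc t)) =
    (let (x, zs) = trajectory M d \<omega> (Suc t);
         u = actions_of M (d (Suc t) zs) x;
         y = (\<lambda>i\<in>{1..nsub M}.
                dyn M (Suc t) (type_of M i) (empirical M x) (x i) (u i) (noise M i (Suc t) \<omega>))
     in (y, zs @ [empirical M y]))"

definition state_at ::
  "('x, 'u, 'w, 'a) mft \<Rightarrow> ('x, 'u) coord_strategy \<Rightarrow> nat \<Rightarrow> 'a \<Rightarrow> nat \<Rightarrow> 'x" where
  "state_at M d t \<omega> = fst (trajectory M d \<omega> t)"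

definition mf_at ::
  "('x, 'u, 'w, 'a) mft \<Rightarrow> ('x, 'u) coord_strategy \<Rightarrow> nat \<Rightarrow> 'a \<Rightarrow> 'x mean_field" where
  "mf_at M d t \<omega> = empirical M (state_at M d t \<omega>)"

definition prescription_at ::
  "('x, 'u, 'w, 'a) mft \<Rightarrow> ('x, 'u) coord_strategy \<Rightarrow> nat \<Rightarrow> 'a \<Rightarrow> ('x, 'u) prescription" where
  "prescription_at M d t \<omega> = d t (snd (trajectory M d \<omega> t))"

definition action_at ::
  "('x, 'u, 'w, 'a) mft \<Rightarrow> ('x, 'u) coord_strategy \<Rightarrow> nat \<Rightarrow> 'a \<Rightarrow> nat \<Rightarrow> 'u" where
  "action_at M d t \<omega> = actions_of M (prescription_at M d t \<omega>) (state_at M d t \<omega>)"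

definition decision_rule :: "('x, 'u) strategy \<Rightarrow> ('x, 'u) coord_strategy" where
  "decision_rule g = (\<lambda>t zs (\<theta>, x). g t \<theta> zs x)"

definition expected_cost :: "('x, 'u, 'w, 'a) mft \<Rightarrow> ('x, 'u) strategy \<Rightarrow> real" where
  "expected_cost M g =
    (LINT \<omega>|base M. (\<Sum>t=1..horizon M.
      cost M t (state_at M (decision_rule g) t \<omega>) (action_at M (decision_rule g) t \<omega>)))"

definition optimal :: "('x, 'u, 'w, 'a) mft \<Rightarrow> ('x, 'u) strategy \<Rightarrow> bool" where
  "optimal M g \<longleftrightarrow>
    g \<in> strategies M \<and> (\<forall>g'\<in>strategies M. expected_cost M g \<le> expected_cost M g')"

definition info_event ::
  "('x, 'u, 'w, 'a) mft \<Rightarrow> ('x, 'u) coord_strategy \<Rightarrow> nat \<Rightarrow> 'x mean_field \<Rightarrow>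
    ('x, 'u) prescription \<Rightarrow> 'a set" where
  "info_event M \<psi> t z \<gamma> =
    {\<omega> \<in> space (base M). mf_at M \<psi> t \<omega> = z \<and> prescription_at M \<psi> t \<omega> = \<gamma>}"

definition reaching ::
  "('x, 'u, 'w, 'a) mft \<Rightarrow> nat \<Rightarrow> 'x mean_field \<Rightarrow> ('x, 'u) prescription \<Rightarrow>
    ('x, 'u) coord_strategy set" where
  "reaching M t z \<gamma> = {\<psi> \<in> coord_strategies M. measure (base M) (info_event M \<psi> t z \<gamma>) > 0}"

text \<open>
  The per-step cost and the transition law of the coordinated system, as conditional expectation
  and conditional law given the event \<open>info_event M \<psi> t z \<gamma>\<close>.  The conditional values do not
  depend on \<open>\<psi>\<close>; in order not to assume this, a version is only required to agree with
  one coordination strategy \<open>\<psi>\<close> reaching \<open>(z, \<gamma>)\<close>, which may vary with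
  \<open>t\<close>, \<open>z\<close> and \<open>\<gamma>\<close>.  At pairs that no coordination strategy reaches, the values are arbitrary.
\<close>

definition is_conditional_cost ::
  "('x, 'u, 'w, 'a) mft \<Rightarrow> (nat \<Rightarrow> 'x mean_field \<Rightarrow> ('x, 'u) prescription \<Rightarrow> real) \<Rightarrow> bool" where
  "is_conditional_cost M L \<longleftrightarrow>
    (\<forall>t\<in>{1..horizon M}. \<forall>z\<in>mean_fields M. \<forall>\<gamma>\<in>prescriptions M.
      reaching M t z \<gamma> \<noteq> {} \<longrightarrow>
      (\<exists>\<psi>\<in>reaching M t z \<gamma>. L t z \<gamma> =
        (LINT \<omega>:info_event M \<psi> t z \<gamma>|base M. cost M t (state_at M \<psi> t \<omega>) (action_at M \<psi> t \<omega>))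
          / measure (base M) (info_event M \<psi> t z \<gamma>)))"

definition is_conditional_law ::
  "('x, 'u, 'w, 'a) mft \<Rightarrow>
    (nat \<Rightarrow> 'x mean_field \<Rightarrow> ('x, 'u) prescription \<Rightarrow> 'x mean_field pmf) \<Rightarrow> bool" where
  "is_conditional_law M Q \<longleftrightarrow>
    (\<forall>t\<in>{1..horizon M}. \<forall>z\<in>mean_fields M. \<forall>\<gamma>\<in>prescriptions M.
      set_pmf (Q t z \<gamma>) \<subseteq> mean_fields M \<and>
      (reaching M t z \<gamma> \<noteq> {} \<longrightarrow>
      (\<exists>\<psi>\<in>reaching M t z \<gamma>. \<forall>z'\<in>mean_fields M. pmf (Q t z \<gamma>) z' =
        \<P>(\<omega> in base M. mf_at M \<psi> (Suc t) \<omega> = z' \<bar>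
          mf_at M \<psi> t \<omega> = z \<and> prescription_at M \<psi> t \<omega> = \<gamma>))))"

function value_fn ::
  "('x, 'u, 'w, 'a) mft \<Rightarrow> (nat \<Rightarrow> 'x mean_field \<Rightarrow> ('x, 'u) prescription \<Rightarrow> real) \<Rightarrow>
    (nat \<Rightarrow> 'x mean_field \<Rightarrow> ('x, 'u) prescription \<Rightarrow> 'x mean_field pmf) \<Rightarrow>
    nat \<Rightarrow> 'x mean_field \<Rightarrow> real" where
  "value_fn M L Q t z =
    (if t > horizon M then 0
     else Min ((\<lambda>\<gamma>. L t z \<gamma> +
       measure_pmf.expectation (Q t z \<gamma>) (\<lambda>z'. value_fn M L Q (Suc t) z')) ` prescriptions M))"
  by pat_completeness auto
termination
  by (relation "Wellfounded.measure (\<lambda>(M, L, Q, t, z). Suc (horizon M) - t)") auto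

declare value_fn.simps [simp del]

definition dp_solution ::
  "('x, 'u, 'w, 'a) mft \<Rightarrow> (nat \<Rightarrow> 'x mean_field \<Rightarrow> ('x, 'u) prescription \<Rightarrow> real) \<Rightarrow>
    (nat \<Rightarrow> 'x mean_field \<Rightarrow> ('x, 'u) prescription \<Rightarrow> 'x mean_field pmf) \<Rightarrow>
    (nat \<Rightarrow> 'x mean_field \<Rightarrow> ('x, 'u) prescription) \<Rightarrow> bool" where
  "dp_solution M L Q \<psi> \<longleftrightarrow>
    (\<forall>t\<in>{1..horizon M}. \<forall>z\<in>mean_fields M.
      is_arg_min
        (\<lambda>\<gamma>. L t z \<gamma> + measure_pmf.expectation (Q t z \<gamma>) (value_fn M L Q (Suc t)))
        (\<lambda>\<gamma>. \<gamma> \<in> prescriptions M) (\<psi> t z))"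

definition induced_strategy ::
  "(nat \<Rightarrow> 'x mean_field \<Rightarrow> ('x, 'u) prescription) \<Rightarrow> ('x, 'u) strategy" where
  "induced_strategy \<psi> = (\<lambda>t \<theta> zs x. \<psi> t (last zs) (\<theta>, x))"

end

theory Submission
  imports Defs "HOL-Combinatorics.Permutations"
begin

text \<open>
  The local laws used at one time form a prescription, so each control strategy generates
  the same trajectories as a coordination strategy (\<open>trajectory_coordination_of\<close>), and
  optimality over control strategies can be decided in the coordinated system.
  There the coordinator observes only the mean-field history, and the crucial fact is that, given
  the whole history \<open>Z 1, ..., Z t\<close>, the state profile is uniformly distributed over the profiles
  whose empirical distribution is \<open>Z t\<close>, whatever coordination strategy is used
  (\<open>visits_prob_uniform\<close>).  The reason is symmetry.  Two profiles have the same empirical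
  distribution exactly when a permutation of the subsystems that preserves types carries one to the
  other (\<open>empirical_eqD\<close>, \<open>empirical_composed\<close>).  Since subsystems of one type
  have the same dynamics, the same prescription and identically distributed primitive variables,
  and since all primitive variables are independent, permuting a profile in this way does
  not change its joint probability with the mean-field history (\<open>visits_prob_composed\<close>).

  It follows that the conditional expected cost and the conditional law of the next mean-field given
  the history depend on the current mean-field and prescription alone, and are averages over a
  fibre of \<open>empirical\<close> (\<open>cost_expectation\<close>, \<open>next_expectation\<close>).  Hence every \<open>L\<close> and
  \<open>Q\<close> satisfying the hypotheses coincide with these averages at each pair that some coordination
  strategy reaches, and the cost of a coordination strategy exceeds the expected initial value
  of the dynamic program by a sum of nonnegative Bellman gaps, weighted with the probabilities of
  the histories (\<open>coordination_cost_telescope\<close>).  All gaps vanish for a solution of the dynamic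
  program.  The arbitrary values of \<open>L\<close> and \<open>Q\<close> at unreached pairs do enter the minima, but are
  harmless: the last mean-field of a history of positive probability and the prescription chosen after
  it form a pair that is reached by the very strategy under consideration (\<open>history_reaching\<close>).
\<close>

section \<open>Profiles and trajectories\<close>

definition fibre :: "('x, 'u, 'w, 'a) mft \<Rightarrow> 'x mean_field \<Rightarrow> (nat \<Rightarrow> 'x) set" where
  "fibre M z = {x \<in> state_profiles M. empirical M x = z}"

lemma trajectory_Suc:
  fixes M :: "('x, 'u, 'w, 'a) mft"
  assumes "1 \<le> t"
  shows "trajectory M d \<omega> (Suc t) =
    (let (x, zs) = trajectory M d \<omega> t;
         y = (\<lambda>i\<in>{1..nsub M}. dyn M t (type_of M i) (empirical M x) (x i)
                (d t zs (type_of M i, x i)) (noise M i t \<omega>))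
     in (y, zs @ [empirical M y]))"
proof -
  obtain s where "t = Suc s" using assms by (cases t) auto
  then show ?thesis by (simp add: Let_def split_beta actions_of_def cong: restrict_cong)
qed

lemma trajectory_1:
  "trajectory M d \<omega> 1 =
    (let x = (\<lambda>i\<in>{1..nsub M}. init M i \<omega>) in (x, [empirical M x]))"
  by simp

context mft_model
begin

lemma finite_state_profiles: "finite (state_profiles M)"
  unfolding state_profiles_def using types finite_states by (intro finite_PiE) auto

lemma finite_mean_fields: "finite (mean_fields M)"
  unfolding mean_fields_def using finite_state_profiles by simp

lemma finite_mf_histories: "finite (mf_histories M t)"
  using finite_lists_length_eq[OF finite_mean_fields, of t]
  by (simp add: mf_histories_def conj_commute)

lemma finite_fibre: "finite (fibre M z)"
  unfolding fibre_def using finite_state_profiles by simp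

lemma finite_prescriptions: "finite (prescriptions M)"
  unfolding prescriptions_def using finite_states finite_actions
  by (intro finite_PiE finite_SigmaI) auto

lemma prescriptions_nonempty: "prescriptions M \<noteq> {}"
  unfolding prescriptions_def PiE_eq_empty_iff using actions_nonempty by fastforce

lemma state_profilesD: "x \<in> state_profiles M \<Longrightarrow> i \<in> {1..nsub M} \<Longrightarrow> x i \<in> state_set M (type_of M i)"
  unfolding state_profiles_def by (rule PiE_mem)

lemma prescription_action:
  assumes "\<gamma> \<in> prescriptions M" "x \<in> state_profiles M" "i \<in> {1..nsub M}"
  shows "\<gamma> (type_of M i, x i) \<in> action_set M (type_of M i)"
proof -
  have "(type_of M i, x i) \<in> (SIGMA \<theta>:{1..ntyp M}. state_set M \<theta>)"
    using types[OF assms(3)] state_profilesD[OF assms(2,3)] by simp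
  from PiE_mem[OF assms(1)[unfolded prescriptions_def] this] show ?thesis by simp
qed

lemma coord_strategiesD:
  "d \<in> coord_strategies M \<Longrightarrow> t \<in> {1..horizon M} \<Longrightarrow> zs \<in> mf_histories M t \<Longrightarrow>
    d t zs \<in> prescriptions M"
  unfolding coord_strategies_def by blast

lemma empirical_in: "x \<in> state_profiles M \<Longrightarrow> empirical M x \<in> mean_fields M"
  unfolding mean_fields_def by simp

lemma last_history_in: "zs \<in> mf_histories M t \<Longrightarrow> 1 \<le> t \<Longrightarrow> last zs \<in> mean_fields M"
  unfolding mf_histories_def by (cases zs rule: rev_cases) auto

lemma snoc_history_iff:
  "zs @ [z] \<in> mf_histories M (Suc t) \<longleftrightarrow> zs \<in> mf_histories M t \<and> z \<in> mean_fields M"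
  unfolding mf_histories_def by auto

lemma dyn_in_state_set:
  assumes "t \<in> {1..horizon M}" "i \<in> {1..nsub M}" "z \<in> mean_fields M"
    "a \<in> state_set M (type_of M i)" "u \<in> action_set M (type_of M i)" "\<omega> \<in> space (base M)"
  shows "dyn M t (type_of M i) z a u (noise M i t \<omega>) \<in> state_set M (type_of M i)"
  using measurable_space[OF dyn_measurable[OF assms(1) types[OF assms(2)] assms(3-5)]
      measurable_space[OF noise_rv[OF assms(2,1)] assms(6)]] by simp

lemma trajectory_range:
  assumes d: "d \<in> coord_strategies M" and \<omega>: "\<omega> \<in> space (base M)"
  shows "1 \<le> t \<Longrightarrow> t \<le> Suc (horizon M) \<Longrightarrow>
    fst (trajectory M d \<omega> t) \<in> state_profiles M \<and>
    snd (trajectory M d \<omega> t) \<in> mf_histories M t \<and>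
    last (snd (trajectory M d \<omega> t)) = empirical M (fst (trajectory M d \<omega> t))"
proof (induction t rule: nat_induct_at_least)
  case base
  define x where "x = (\<lambda>i\<in>{1..nsub M}. init M i \<omega>)"
  have "x \<in> state_profiles M"
    unfolding state_profiles_def x_def using measurable_space[OF init_rv \<omega>] by (simp add: PiE_iff)
  then show ?case
    unfolding trajectory_1 Let_def x_def[symmetric] by (simp add: mf_histories_def empirical_in)
next
  case (Suc t)
  obtain x zs where xzs: "trajectory M d \<omega> t = (x, zs)" by (cases "trajectory M d \<omega> t")
  from Suc xzs have x: "x \<in> state_profiles M" and zs: "zs \<in> mf_histories M t" by auto
  have t: "t \<in> {1..horizon M}" using Suc by simp
  define y where "y = (\<lambda>i\<in>{1..nsub M}. dyn M t (type_of M i) (empirical M x) (x i)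
                (d t zs (type_of M i, x i)) (noise M i t \<omega>))"
  have "y \<in> state_profiles M"
    unfolding state_profiles_def y_def PiE_iff
    using dyn_in_state_set[OF t _ empirical_in[OF x] state_profilesD[OF x]
        prescription_action[OF coord_strategiesD[OF d t zs] x] \<omega>] by simp
  moreover have "trajectory M d \<omega> (Suc t) = (y, zs @ [empirical M y])"
    using xzs by (simp add: trajectory_Suc[OF Suc(1)] y_def Let_def)
  ultimately show ?case using zs by (simp add: snoc_history_iff empirical_in)
qed

end

section \<open>Independence of the past and the current noise\<close>

definition visits ::
  "('x, 'u, 'w, 'a) mft \<Rightarrow> ('x, 'u) coord_strategy \<Rightarrow> nat \<Rightarrow> (nat \<Rightarrow> 'x) \<Rightarrow>
    'x mean_field list \<Rightarrow> 'a set" where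
  "visits M d t x zs = {\<omega> \<in> space (base M). trajectory M d \<omega> t = (x, zs)}"

text \<open>
  Indices of the primitive variables that determine the state profile at time \<open>t\<close>: the initial
  states and the noise before \<open>t\<close>.
\<close>

definition past :: "('x, 'u, 'w, 'a) mft \<Rightarrow> nat \<Rightarrow> (nat + nat \<times> nat) set" where
  "past M t = {1..nsub M} <+> {1..nsub M} \<times> {1..<t}"

definition noise_event ::
  "('x, 'u, 'w, 'a) mft \<Rightarrow> nat \<Rightarrow> nat \<Rightarrow> 'x mean_field \<Rightarrow> 'x \<Rightarrow> 'u \<Rightarrow> 'x \<Rightarrow> 'a set" where
  "noise_event M t i z a u b =
    {\<omega> \<in> space (base M). dyn M t (type_of M i) z a u (noise M i t \<omega>) = b}"

text \<open>
  A product over the subsystems, because their noise variables at time \<open>t\<close> are independent.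
\<close>

definition transition_prob ::
  "('x, 'u, 'w, 'a) mft \<Rightarrow> nat \<Rightarrow> ('x, 'u) prescription \<Rightarrow> (nat \<Rightarrow> 'x) \<Rightarrow> (nat \<Rightarrow> 'x) \<Rightarrow> real" where
  "transition_prob M t \<gamma> x y = (\<Prod>i\<in>{1..nsub M}. measure (base M)
    (noise_event M t i (empirical M x) (x i) (\<gamma> (type_of M i, x i)) (y i)))"

context mft_model
begin

lemma visits_empty:
  assumes "d \<in> coord_strategies M" "1 \<le> t" "t \<le> Suc (horizon M)"
    "\<not> (x \<in> fibre M (last zs) \<and> zs \<in> mf_histories M t)"
  shows "visits M d t x zs = {}"
  using trajectory_range[OF assms(1) _ assms(2,3)] assms(4)
  unfolding visits_def fibre_def by force

lemma primitive_events_init: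
  assumes "i \<in> {1..nsub M}" "a \<in> state_set M (type_of M i)"
  shows "{\<omega> \<in> space (base M). init M i \<omega> = a} \<in> primitive_events M (Inl i)"
proof -
  have "{\<omega> \<in> space (base M). init M i \<omega> = a} = init M i -` {a} \<inter> space (base M)" by auto
  then show ?thesis unfolding primitive_events_def using assms(2) by (auto intro!: exI[of _ "{a}"])
qed

lemma primitive_events_noise:
  assumes "t \<in> {1..horizon M}" "i \<in> {1..nsub M}" "z \<in> mean_fields M"
    "a \<in> state_set M (type_of M i)" "u \<in> action_set M (type_of M i)"
    "b \<in> state_set M (type_of M i)"
  shows "noise_event M t i z a u b \<in> primitive_events M (Inr (i, t))"
proof -
  let ?A = "dyn M t (type_of M i) z a u -` {b} \<inter> space (noise_space M t (type_of M i))"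
  have "?A \<in> sets (noise_space M t (type_of M i))"
    using measurable_sets[OF dyn_measurable[OF assms(1) types[OF assms(2)] assms(3-5)], of "{b}"]
      assms(6) by simp
  moreover have "noise_event M t i z a u b = noise M i t -` ?A \<inter> space (base M)"
    using measurable_space[OF noise_rv[OF assms(2,1)]] unfolding noise_event_def by auto
  ultimately show ?thesis unfolding primitive_events_def by (simp del: vimage_Int) blast
qed

lemma primitive_events_sets:
  "j \<in> {1..nsub M} <+> {1..nsub M} \<times> {1..horizon M} \<Longrightarrow> primitive_events M j \<subseteq> events"
  using independent unfolding indep_sets_def by auto

text \<open>
  Intersection stability lets independence pass from the primitive events to the
  \<open>\<sigma>\<close>-algebras generated by groups of them.
\<close>

lemma Int_stable_primitive_events: "Int_stable (primitive_events M j)"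
proof (rule Int_stableI)
  fix A B assume "A \<in> primitive_events M j" "B \<in> primitive_events M j"
  then show "A \<inter> B \<in> primitive_events M j"
  proof (cases j)
    case (Inl i)
    with \<open>A \<in> _\<close> \<open>B \<in> _\<close> obtain A' B' where
      "A = init M i -` A' \<inter> space (base M)" "B = init M i -` B' \<inter> space (base M)"
      "A' \<subseteq> state_set M (type_of M i)" "B' \<subseteq> state_set M (type_of M i)"
      unfolding primitive_events_def by auto
    then have "A \<inter> B = init M i -` (A' \<inter> B') \<inter> space (base M)"
      "A' \<inter> B' \<subseteq> state_set M (type_of M i)" by auto
    then show ?thesis using Inl unfolding primitive_events_def by (simp del: vimage_Int) blast
  next
    case (Inr p)
    obtain i t where p: "p = (i, t)" by (cases p)
    from Inr p \<open>A \<in> _\<close> \<open>B \<in> _\<close> obtain A' B' where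
      "A = noise M i t -` A' \<inter> space (base M)" "B = noise M i t -` B' \<inter> space (base M)"
      "A' \<in> sets (noise_space M t (type_of M i))" "B' \<in> sets (noise_space M t (type_of M i))"
      unfolding primitive_events_def by auto
    then have "A \<inter> B = noise M i t -` (A' \<inter> B') \<inter> space (base M)"
      "A' \<inter> B' \<in> sets (noise_space M t (type_of M i))" by auto
    then show ?thesis using Inr p unfolding primitive_events_def by (simp del: vimage_Int) blast
  qed
qed

lemma step_event:
  assumes "1 \<le> t" "y \<in> state_profiles M"
  shows "{\<omega> \<in> space (base M). trajectory M d \<omega> t = (x, zs) \<and> state_at M d (Suc t) \<omega> = y} =
    visits M d t x zs \<inter> (\<Inter>i\<in>{1..nsub M}.
      noise_event M t i (empirical M x) (x i) (d t zs (type_of M i, x i)) (y i))"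
proof -
  have "restrict F {1..nsub M} = y \<longleftrightarrow> (\<forall>i\<in>{1..nsub M}. F i = y i)" for F
    using assms(2) unfolding state_profiles_def
    by (auto simp: fun_eq_iff PiE_iff extensional_def restrict_def)
  then show ?thesis
    using nsub_pos by (auto simp: visits_def state_at_def trajectory_Suc[OF assms(1)] noise_event_def Let_def)
qed

lemma visits_Suc:
  assumes "d \<in> coord_strategies M" "t \<in> {1..horizon M}"
  shows "visits M d (Suc t) y (zs @ [empirical M y]) = (\<Union>x\<in>state_profiles M.
    {\<omega> \<in> space (base M). trajectory M d \<omega> t = (x, zs) \<and> state_at M d (Suc t) \<omega> = y})"
proof -
  have t: "1 \<le> t" using assms by simp
  have "fst (trajectory M d \<omega> t) \<in> state_profiles M" if "\<omega> \<in> space (base M)" for \<omega>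
    using trajectory_range[OF assms(1) that, of t] assms(2) by simp
  then show ?thesis
    by (auto simp: visits_def state_at_def trajectory_Suc[OF t] Let_def split_beta prod_eq_iff)
qed

lemma visits_initial:
  assumes "x \<in> state_profiles M"
  shows "visits M d 1 x [empirical M x] =
    (\<Inter>i\<in>{1..nsub M}. {\<omega> \<in> space (base M). init M i \<omega> = x i})"
proof -
  have "restrict F {1..nsub M} = x \<longleftrightarrow> (\<forall>i\<in>{1..nsub M}. F i = x i)" for F
    using assms unfolding state_profiles_def
    by (auto simp: fun_eq_iff PiE_iff extensional_def restrict_def)
  then have "trajectory M d \<omega> 1 = (x, [empirical M x]) \<longleftrightarrow> (\<forall>i\<in>{1..nsub M}. init M i \<omega> = x i)" for \<omega>
    unfolding trajectory_1 Let_def prod.inject by metis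
  then show ?thesis using nsub_pos unfolding visits_def by auto
qed

text \<open>
  Measurability with respect to the past: the trajectory up to time \<open>t\<close> is a function of the
  initial states and of the noise before \<open>t\<close>.  As a profile has finitely many possible predecessors,
  the events can be built up by finite unions and intersections.
\<close>

lemma visits_past:
  assumes d: "d \<in> coord_strategies M"
  shows "1 \<le> t \<Longrightarrow> t \<le> Suc (horizon M) \<Longrightarrow>
    visits M d t x zs \<in> sigma_sets (space (base M)) (\<Union>j\<in>past M t. primitive_events M j)"
proof (induction t arbitrary: x zs rule: nat_induct_at_least)
  case base
  let ?S = "sigma_sets (space (base M)) (\<Union>j\<in>past M 1. primitive_events M j)"
  have sub: "(\<Union>j\<in>past M 1. primitive_events M j) \<subseteq> Pow (space (base M))"
    unfolding primitive_events_def by (auto split: sum.splits)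
  interpret S: sigma_algebra "space (base M)" ?S by (rule sigma_algebra_sigma_sets[OF sub])
  show ?case
  proof (cases "x \<in> state_profiles M \<and> zs = [empirical M x]")
    case True
    have "{\<omega> \<in> space (base M). init M i \<omega> = x i} \<in> ?S" if "i \<in> {1..nsub M}" for i
    proof (intro sigma_sets.Basic UN_I)
      show "Inl i \<in> past M 1" using that unfolding past_def by (rule InlI)
      show "{\<omega> \<in> space (base M). init M i \<omega> = x i} \<in> primitive_events M (Inl i)"
        using primitive_events_init[OF that] state_profilesD[OF _ that] True by blast
    qed
    then have "(\<Inter>i\<in>{1..nsub M}. {\<omega> \<in> space (base M). init M i \<omega> = x i}) \<in> ?S"
      using nsub_pos by (intro S.finite_INT) auto
    then show ?thesis using True visits_initial by simp
  next
    case False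
    have "visits M d 1 x zs = {}"
    proof (cases "x \<in> state_profiles M")
      case True
      with False show ?thesis by (auto simp: visits_def Let_def)
    next
      case False
      then show ?thesis by (intro visits_empty[OF d]) (auto simp: fibre_def)
    qed
    then show ?thesis by (simp add: sigma_sets.Empty)
  qed
next
  case (Suc t)
  let ?E = "\<lambda>t. \<Union>j\<in>past M t. primitive_events M j"
  let ?S = "sigma_sets (space (base M)) (?E (Suc t))"
  have sub: "?E (Suc t) \<subseteq> Pow (space (base M))"
    unfolding primitive_events_def by (auto split: sum.splits)
  interpret S: sigma_algebra "space (base M)" ?S by (rule sigma_algebra_sigma_sets[OF sub])
  have t: "t \<in> {1..horizon M}" "1 \<le> t" using Suc by auto
  show ?case
  proof (cases "x \<in> fibre M (last zs) \<and> zs \<in> mf_histories M (Suc t)")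
    case False
    then have "visits M d (Suc t) x zs = {}" using Suc by (intro visits_empty[OF d]) auto
    then show ?thesis by (simp add: sigma_sets.Empty)
  next
    case True
    then obtain ys where ys: "zs = ys @ [empirical M x]"
      by (cases zs rule: rev_cases) (auto simp: fibre_def mf_histories_def)
    have x: "x \<in> state_profiles M" using True by (simp add: fibre_def)
    have ysh: "ys \<in> mf_histories M t" using True ys by (simp add: snoc_history_iff)
    have "visits M d t w ys \<inter> (\<Inter>i\<in>{1..nsub M}.
        noise_event M t i (empirical M w) (w i) (d t ys (type_of M i, w i)) (x i)) \<in> ?S"
      if w: "w \<in> state_profiles M" for w
    proof (rule S.Int)
      have "past M t \<subseteq> past M (Suc t)" by (auto simp: past_def)
      then have "sigma_sets (space (base M)) (?E t) \<subseteq> ?S"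
        by (intro sigma_sets_mono') auto
      then show "visits M d t w ys \<in> ?S" using Suc by auto
      have "noise_event M t i (empirical M w) (w i) (d t ys (type_of M i, w i)) (x i) \<in> ?S"
        if "i \<in> {1..nsub M}" for i
        using primitive_events_noise[OF t(1) that empirical_in[OF w] state_profilesD[OF w that]
            prescription_action[OF coord_strategiesD[OF d t(1) ysh] w that] state_profilesD[OF x that]]
          that t by (intro sigma_sets.Basic) (auto simp: past_def)
      then show "(\<Inter>i\<in>{1..nsub M}. noise_event M t i (empirical M w) (w i)
          (d t ys (type_of M i, w i)) (x i)) \<in> ?S"
        using nsub_pos by (intro S.finite_INT) auto
    qed
    then show ?thesis
      unfolding ys visits_Suc[OF d t(1)] step_event[OF t(2) x]
      using finite_state_profiles by (intro S.finite_UN) auto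
  qed
qed

lemma past_sigma_sets_events:
  assumes "t \<le> Suc (horizon M)"
  shows "sigma_sets (space (base M)) (\<Union>j\<in>past M t. primitive_events M j) \<subseteq> events"
proof (rule sets.sigma_sets_subset, rule UN_least, rule primitive_events_sets)
  fix j assume "j \<in> past M t"
  then show "j \<in> {1..nsub M} <+> {1..nsub M} \<times> {1..horizon M}"
    using assms by (auto simp: past_def)
qed

lemma visits_event:
  assumes "d \<in> coord_strategies M" "1 \<le> t" "t \<le> Suc (horizon M)"
  shows "visits M d t x zs \<in> events"
  using visits_past[OF assms] past_sigma_sets_events[OF assms(3)] by blast

text \<open>
  The factorisation behind the Markov property: the noise variables at time \<open>t\<close> are independent of
  the past and of each other.
\<close>

lemma step_prob:
  assumes d: "d \<in> coord_strategies M" and t: "t \<in> {1..horizon M}"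
    and x: "x \<in> state_profiles M" and zs: "zs \<in> mf_histories M t" and y: "y \<in> state_profiles M"
  shows "prob {\<omega> \<in> space (base M). trajectory M d \<omega> t = (x, zs) \<and> state_at M d (Suc t) \<omega> = y} =
    prob (visits M d t x zs) * transition_prob M t (d t zs) x y"
proof -
  \<comment> \<open>Group \<open>0\<close> is the past, and group \<open>i\<close> with \<open>1 \<le> i\<close> is the noise of subsystem \<open>i\<close> at time \<open>t\<close>.\<close>
  define I where "I = (\<lambda>k::nat. if k = 0 then past M t else {Inr (k, t)})"
  let ?\<S> = "\<lambda>k. sigma_sets (space (base M)) (\<Union>j\<in>I k. primitive_events M j)"
  let ?N = "\<lambda>i. noise_event M t i (empirical M x) (x i) (d t zs (type_of M i, x i)) (y i)"
  define B where "B = (\<lambda>k. if k = 0 then visits M d t x zs else ?N k)"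
  have "(\<Union>k\<in>{0..nsub M}. I k) \<subseteq> {1..nsub M} <+> {1..nsub M} \<times> {1..horizon M}"
    using t by (auto simp: I_def past_def split: if_splits)
  then have "indep_sets (primitive_events M) (\<Union>k\<in>{0..nsub M}. I k)"
    using independent indep_sets_mono_index by blast
  moreover have "disjoint_family_on I {0..nsub M}"
    by (auto simp: disjoint_family_on_def I_def past_def)
  ultimately have ind: "indep_sets ?\<S> {0..nsub M}"
    using Int_stable_primitive_events by (intro indep_sets_collect_sigma) auto
  have N: "?N i \<in> primitive_events M (Inr (i, t))" if "i \<in> {1..nsub M}" for i
    by (rule primitive_events_noise[OF t that empirical_in[OF x] state_profilesD[OF x that]
      prescription_action[OF coord_strategiesD[OF d t zs] x that] state_profilesD[OF y that]])
  have "B k \<in> ?\<S> k" if "k \<in> {0..nsub M}" for k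
    using that N[of k] visits_past[OF d, of t x zs] t
    by (auto simp: B_def I_def intro!: sigma_sets.Basic)
  then have "prob (\<Inter>k\<in>{0..nsub M}. B k) = (\<Prod>k\<in>{0..nsub M}. prob (B k))"
    by (intro indep_setsD[OF ind]) auto
  moreover have "{0..nsub M} = insert 0 {1..nsub M}" by auto
  moreover have "(\<Inter>k\<in>{1..nsub M}. B k) = (\<Inter>k\<in>{1..nsub M}. ?N k)" 
    by (auto simp: B_def)
  moreover have "(\<Prod>k\<in>{1..nsub M}. prob (B k)) = transition_prob M t (d t zs) x y"
    unfolding transition_prob_def by (intro prod.cong) (auto simp: B_def)
  ultimately have "prob (B 0 \<inter> (\<Inter>k\<in>{1..nsub M}. ?N k)) =
      prob (B 0) * transition_prob M t (d t zs) x y" by simp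
  then show ?thesis using step_event[of t y d x zs] t y by (simp add: B_def)
qed

lemma step_event_in_events:
  assumes d: "d \<in> coord_strategies M" and t: "t \<in> {1..horizon M}"
    and y: "y \<in> state_profiles M"
  shows "{\<omega> \<in> space (base M). trajectory M d \<omega> t = (x, zs) \<and> state_at M d (Suc t) \<omega> = y} \<in> events"
proof -
  have "{\<omega> \<in> space (base M). trajectory M d \<omega> t = (x, zs) \<and> state_at M d (Suc t) \<omega> = y} =
    visits M d t x zs \<inter> visits M d (Suc t) y (zs @ [empirical M y])"
    using t by (auto simp: visits_def state_at_def trajectory_Suc Let_def)
  then show ?thesis using visits_event[OF d] t by auto
qed

lemma visits_Suc_prob:
  assumes d: "d \<in> coord_strategies M" and t: "t \<in> {1..horizon M}"
    and zs: "zs \<in> mf_histories M t" and y: "y \<in> state_profiles M"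
  shows "prob (visits M d (Suc t) y (zs @ [empirical M y])) =
    (\<Sum>x\<in>state_profiles M. prob (visits M d t x zs) * transition_prob M t (d t zs) x y)"
  unfolding visits_Suc[OF d t]
  by (subst finite_measure_finite_Union[OF finite_state_profiles])
    (auto simp: disjoint_family_on_def step_prob[OF d t _ zs y]
      intro!: step_event_in_events[OF d t y])

end

section \<open>Symmetry under type-preserving permutations\<close>

definition type_symmetry :: "('x, 'u, 'w, 'a) mft \<Rightarrow> (nat \<Rightarrow> nat) \<Rightarrow> bool" where
  "type_symmetry M \<sigma> \<longleftrightarrow>
    \<sigma> permutes {1..nsub M} \<and> (\<forall>i\<in>{1..nsub M}. type_of M (\<sigma> i) = type_of M i)"

context mft_model
begin

lemma composed_profile:
  assumes "type_symmetry M \<sigma>" "x \<in> state_profiles M"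
  shows "x \<circ> \<sigma> \<in> state_profiles M"
proof -
  have p: "\<sigma> permutes {1..nsub M}" using assms(1) by (simp add: type_symmetry_def)
  have "x (\<sigma> i) \<in> state_set M (type_of M i)" if "i \<in> {1..nsub M}" for i
    using state_profilesD[OF assms(2), of "\<sigma> i"] permutes_in_image[OF p, of i] that assms(1)
    by (simp add: type_symmetry_def)
  moreover have "x (\<sigma> i) = undefined" if "i \<notin> {1..nsub M}" for i
    using permutes_not_in[OF p that] assms(2) that
    by (auto simp: state_profiles_def PiE_iff extensional_def)
  ultimately show ?thesis by (auto simp: state_profiles_def PiE_iff extensional_def)
qed

lemma empirical_composed:
  assumes "type_symmetry M \<sigma>"
  shows "empirical M (x \<circ> \<sigma>) = empirical M x"
proof -
  have p: "\<sigma> permutes {1..nsub M}" using assms by (simp add: type_symmetry_def)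
  have "empirical M (x \<circ> \<sigma>) =
      map_pmf (\<lambda>i. (type_of M (\<sigma> i), x (\<sigma> i))) (pmf_of_set {1..nsub M})"
    unfolding empirical_def using assms nsub_pos
    by (intro map_pmf_cong) (auto simp: type_symmetry_def)
  also have "\<dots> = map_pmf (\<lambda>i. (type_of M i, x i)) (map_pmf \<sigma> (pmf_of_set {1..nsub M}))"
    by (simp add: pmf.map_comp o_def)
  also have "map_pmf \<sigma> (pmf_of_set {1..nsub M}) = pmf_of_set {1..nsub M}"
    using nsub_pos by (intro map_pmf_of_set_bij_betw permutes_imp_bij[OF p]) auto
  finally show ?thesis by (simp add: empirical_def)
qed

text \<open>
  Equal empirical distributions mean that each pair of a type and a state is taken by equally many
  subsystems in both profiles.  Matching the subsystems with the same pair gives the permutation.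
\<close>

lemma empirical_eqD:
  assumes "x \<in> state_profiles M" "y \<in> state_profiles M" "empirical M x = empirical M y"
  obtains \<sigma> where "type_symmetry M \<sigma>" "x = y \<circ> \<sigma>"
proof -
  let ?f = "\<lambda>x i. (type_of M i, x i)"
  have count: "count (image_mset (?f x) (mset_set {1..nsub M})) p = pmf (empirical M x) p * nsub M" for x p
  proof -
    have "pmf (empirical M x) p = card ({1..nsub M} \<inter> ?f x -` {p}) / card {1..nsub M}"
      unfolding empirical_def pmf_map using nsub_pos by (intro measure_pmf_of_set) auto
    moreover have "count (image_mset (?f x) (mset_set {1..nsub M})) p =
        card ({1..nsub M} \<inter> ?f x -` {p})"
      by (simp add: count_image_mset vimage_def Int_def conj_commute)
    ultimately show ?thesis using nsub_pos by simp
  qed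
  have "image_mset (?f x) (mset_set {1..nsub M}) = image_mset (?f y) (mset_set {1..nsub M})"
  proof (rule multiset_eqI)
    fix p
    have "real (count (image_mset (?f x) (mset_set {1..nsub M})) p) =
        real (count (image_mset (?f y) (mset_set {1..nsub M})) p)"
      unfolding count assms(3) ..
    then show "count (image_mset (?f x) (mset_set {1..nsub M})) p =
        count (image_mset (?f y) (mset_set {1..nsub M})) p" by simp
  qed
  then obtain \<sigma> where \<sigma>: "\<sigma> permutes {1..nsub M}" "\<forall>i\<in>{1..nsub M}. ?f x i = ?f y (\<sigma> i)"
    by (rule image_mset_eq_implies_permutes[OF finite_atLeastAtMost])
  have "x i = y (\<sigma> i)" for i
  proof (cases "i \<in> {1..nsub M}")
    case False
    then show ?thesis using assms(1,2) permutes_not_in[OF \<sigma>(1) False]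
      by (simp add: state_profiles_def PiE_iff extensional_def)
  qed (use \<sigma> in simp)
  then have "x = y \<circ> \<sigma>" by (simp add: fun_eq_iff)
  moreover have "type_symmetry M \<sigma>" using \<sigma> by (simp add: type_symmetry_def)
  ultimately show ?thesis using that by blast
qed

text \<open>
  This and the next lemma are where the assumption of identical distributions enters.
\<close>

lemma init_prob_cong:
  assumes "i \<in> {1..nsub M}" "j \<in> {1..nsub M}" "type_of M i = type_of M j"
    "a \<in> state_set M (type_of M i)"
  shows "prob {\<omega> \<in> space (base M). init M i \<omega> = a} = prob {\<omega> \<in> space (base M). init M j \<omega> = a}"
proof -
  have "prob {\<omega> \<in> space (base M). init M k \<omega> = a} =
      measure (distr (base M) (count_space (state_set M (type_of M k))) (init M k)) {a}"
    if "k \<in> {1..nsub M}" "a \<in> state_set M (type_of M k)" for k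
    using that by (subst measure_distr[OF init_rv]) (auto intro!: arg_cong[where f=prob])
  then show ?thesis using assms init_ident[OF assms(1-3)] by simp
qed

lemma noise_prob_cong:
  assumes "i \<in> {1..nsub M}" "j \<in> {1..nsub M}" "type_of M i = type_of M j"
    and t: "t \<in> {1..horizon M}" "z \<in> mean_fields M"
    and s: "a \<in> state_set M (type_of M i)" "u \<in> action_set M (type_of M i)"
      "b \<in> state_set M (type_of M i)"
  shows "prob (noise_event M t i z a u b) = prob (noise_event M t j z a u b)"
proof -
  let ?A = "\<lambda>k. dyn M t (type_of M k) z a u -` {b} \<inter> space (noise_space M t (type_of M k))"
  have "prob (noise_event M t k z a u b) =
      measure (distr (base M) (noise_space M t (type_of M k)) (noise M k t)) (?A k)"
    if k: "k \<in> {1..nsub M}" "type_of M k = type_of M i" for k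
  proof -
    have "?A k \<in> sets (noise_space M t (type_of M k))"
      using s k by (intro measurable_sets[OF dyn_measurable[OF t(1) types[OF k(1)] t(2)]]) auto
    then have "measure (distr (base M) (noise_space M t (type_of M k)) (noise M k t)) (?A k) =
        prob (noise M k t -` ?A k \<inter> space (base M))"
      by (rule measure_distr[OF noise_rv[OF k(1) t(1)]])
    also have "noise M k t -` ?A k \<inter> space (base M) = noise_event M t k z a u b"
      using measurable_space[OF noise_rv[OF k(1) t(1)]] by (auto simp: noise_event_def)
    finally show ?thesis ..
  qed
  then show ?thesis using assms(1-3) noise_ident[OF assms(1,2) t(1) assms(3)] by simp
qed

text \<open>
  Replacing the noise of subsystem \<open>i\<close> by that of \<open>\<sigma> i\<close>, which has the same type, changes no
  factor of the product, and then the factors are the original ones in a different order.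
\<close>

lemma transition_prob_composed:
  assumes \<sigma>: "type_symmetry M \<sigma>" and t: "t \<in> {1..horizon M}" and \<gamma>: "\<gamma> \<in> prescriptions M"
    and x: "x \<in> state_profiles M" and y: "y \<in> state_profiles M"
  shows "transition_prob M t \<gamma> (x \<circ> \<sigma>) (y \<circ> \<sigma>) = transition_prob M t \<gamma> x y"
proof -
  let ?p = "\<lambda>i k. prob (noise_event M t i (empirical M x) (x k) (\<gamma> (type_of M k, x k)) (y k))"
  have p: "\<sigma> permutes {1..nsub M}" using \<sigma> by (simp add: type_symmetry_def)
  have "transition_prob M t \<gamma> (x \<circ> \<sigma>) (y \<circ> \<sigma>) = (\<Prod>i\<in>{1..nsub M}. ?p i (\<sigma> i))"
    unfolding transition_prob_def empirical_composed[OF \<sigma>]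
    using \<sigma> by (intro prod.cong) (auto simp: type_symmetry_def)
  also have "\<dots> = (\<Prod>i\<in>{1..nsub M}. ?p (\<sigma> i) (\<sigma> i))"
  proof (intro prod.cong refl)
    fix i assume i: "i \<in> {1..nsub M}"
    then have \<sigma>i: "\<sigma> i \<in> {1..nsub M}" "type_of M i = type_of M (\<sigma> i)"
      using permutes_in_image[OF p, of i] \<sigma> by (auto simp: type_symmetry_def)
    show "?p i (\<sigma> i) = ?p (\<sigma> i) (\<sigma> i)"
      using state_profilesD[OF x \<sigma>i(1)] prescription_action[OF \<gamma> x \<sigma>i(1)] state_profilesD[OF y \<sigma>i(1)]
      by (intro noise_prob_cong[OF i \<sigma>i t empirical_in[OF x]]) (auto simp: \<sigma>i(2))
  qed
  also have "\<dots> = (\<Prod>i\<in>{1..nsub M}. ?p i i)"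
    by (rule prod.reindex_bij_betw[OF permutes_imp_bij[OF p]])
  finally show ?thesis by (simp add: transition_prob_def)
qed

lemma sum_profiles_composed:
  assumes "type_symmetry M \<sigma>"
  shows "(\<Sum>x\<in>state_profiles M. F (x \<circ> \<sigma>)) = (\<Sum>x\<in>state_profiles M. F x)"
proof -
  have p: "\<sigma> permutes {1..nsub M}" using assms by (simp add: type_symmetry_def)
  have inj: "inj_on (\<lambda>x. x \<circ> \<sigma>) (state_profiles M)"
    using permutes_surj[OF p] by (auto intro!: inj_onI simp: fun_eq_iff surj_def) metis
  have "(\<lambda>x. x \<circ> \<sigma>) ` state_profiles M = state_profiles M"
    using composed_profile[OF assms]
    by (intro endo_inj_surj[OF finite_state_profiles _ inj]) auto
  then have "bij_betw (\<lambda>x. x \<circ> \<sigma>) (state_profiles M) (state_profiles M)"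
    using inj by (simp add: bij_betw_def)
  then show ?thesis by (rule sum.reindex_bij_betw)
qed

text \<open>
  Exchangeability of the subsystems of each type, jointly with the mean-field history, by induction
  over time: the history does not see the permutation, so the prescription is the same for both
  profiles, and the sum over the predecessors is invariant because \<open>\<sigma>\<close> permutes them too.
\<close>

lemma visits_prob_composed:
  assumes d: "d \<in> coord_strategies M" and \<sigma>: "type_symmetry M \<sigma>"
  shows "1 \<le> t \<Longrightarrow> t \<le> Suc (horizon M) \<Longrightarrow> x \<in> state_profiles M \<Longrightarrow>
    prob (visits M d t (x \<circ> \<sigma>) zs) = prob (visits M d t x zs)"
proof (induction t arbitrary: x zs rule: nat_induct_at_least)
  case base
  have p: "\<sigma> permutes {1..nsub M}" using \<sigma> by (simp add: type_symmetry_def)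
  have x\<sigma>: "x \<circ> \<sigma> \<in> state_profiles M" by (rule composed_profile[OF \<sigma> base(2)])
  show ?case
  proof (cases "zs = [empirical M x]")
    case True
    let ?p = "\<lambda>i k. prob {\<omega> \<in> space (base M). init M i \<omega> = x k}"
    \<comment> \<open>The initial states are independent, so the initial law is a product.\<close>
    have init: "prob (visits M d 1 y [empirical M y]) =
        (\<Prod>i\<in>{1..nsub M}. prob {\<omega> \<in> space (base M). init M i \<omega> = y i})"
      if y: "y \<in> state_profiles M" for y
    proof -
      let ?A = "\<lambda>j :: nat + nat \<times> nat. case j of Inl i \<Rightarrow> {\<omega> \<in> space (base M). init M i \<omega> = y i} | Inr _ \<Rightarrow> {}"
      have "prob (\<Inter>j\<in>Inl ` {1..nsub M}. ?A j) = (\<Prod>j\<in>Inl ` {1..nsub M}. prob (?A j))"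
        using primitive_events_init state_profilesD[OF y] nsub_pos
        by (intro indep_setsD[OF independent]) auto
      then show ?thesis
        unfolding visits_initial[OF y] by (simp add: prod.reindex)
    qed
    have "prob (visits M d 1 (x \<circ> \<sigma>) zs) = (\<Prod>i\<in>{1..nsub M}. ?p i (\<sigma> i))"
      using init[OF x\<sigma>] True by (simp add: empirical_composed[OF \<sigma>])
    also have "\<dots> = (\<Prod>i\<in>{1..nsub M}. ?p (\<sigma> i) (\<sigma> i))"
    proof (intro prod.cong refl)
      fix i assume i: "i \<in> {1..nsub M}"
      then have \<sigma>i: "\<sigma> i \<in> {1..nsub M}" "type_of M i = type_of M (\<sigma> i)"
        using permutes_in_image[OF p, of i] \<sigma> by (auto simp: type_symmetry_def)
      show "?p i (\<sigma> i) = ?p (\<sigma> i) (\<sigma> i)"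
        using state_profilesD[OF base(2) \<sigma>i(1)] by (intro init_prob_cong[OF i \<sigma>i]) (simp add: \<sigma>i(2))
    qed
    also have "\<dots> = (\<Prod>i\<in>{1..nsub M}. ?p i i)"
      by (rule prod.reindex_bij_betw[OF permutes_imp_bij[OF p]])
    finally show ?thesis using init[OF base(2)] True by (simp add: o_def)
  next
    case False
    then have "visits M d 1 x zs = {}" "visits M d 1 (x \<circ> \<sigma>) zs = {}"
      unfolding visits_def trajectory_1 Let_def using empirical_composed[OF \<sigma>, of x] by auto
    then show ?thesis by (simp add: o_def)
  qed
next
  case (Suc t)
  have t: "t \<in> {1..horizon M}" using Suc by simp
  have x\<sigma>: "x \<circ> \<sigma> \<in> state_profiles M" by (rule composed_profile[OF \<sigma> Suc(4)])
  show ?case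
  proof (cases "\<exists>ys\<in>mf_histories M t. zs = ys @ [empirical M x]")
    case True
    then obtain ys where ys: "ys \<in> mf_histories M t" "zs = ys @ [empirical M x]" by blast
    note \<gamma> = coord_strategiesD[OF d t ys(1)]
    have IH: "prob (visits M d t (w \<circ> \<sigma>) ys) = prob (visits M d t w ys)" if "w \<in> state_profiles M" for w
      using Suc.IH[OF _ that] t by (simp add: o_def)
    have "prob (visits M d (Suc t) (x \<circ> \<sigma>) zs) =
        (\<Sum>w\<in>state_profiles M. prob (visits M d t w ys) * transition_prob M t (d t ys) w (x \<circ> \<sigma>))"
      using visits_Suc_prob[OF d t ys(1) x\<sigma>] ys(2) by (simp add: empirical_composed[OF \<sigma>])
    also have "\<dots> = (\<Sum>w\<in>state_profiles M.
        prob (visits M d t (w \<circ> \<sigma>) ys) * transition_prob M t (d t ys) (w \<circ> \<sigma>) (x \<circ> \<sigma>))"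
      by (rule sum_profiles_composed[OF \<sigma>, symmetric])
    also have "\<dots> = (\<Sum>w\<in>state_profiles M.
        prob (visits M d t w ys) * transition_prob M t (d t ys) w x)"
      using Suc.prems by (intro sum.cong) (auto simp: IH transition_prob_composed[OF \<sigma> t \<gamma>])
    also have "\<dots> = prob (visits M d (Suc t) x zs)"
      using visits_Suc_prob[OF d t ys(1) Suc(4)] ys(2) by simp
    finally show ?thesis by (simp add: o_def)
  next
    case False
    have "visits M d (Suc t) y zs = {}" if "empirical M y = empirical M x" for y
    proof (rule visits_empty[OF d])
      show "\<not> (y \<in> fibre M (last zs) \<and> zs \<in> mf_histories M (Suc t))"
      proof
        assume *: "y \<in> fibre M (last zs) \<and> zs \<in> mf_histories M (Suc t)"
        then obtain ys z where "zs = ys @ [z]"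
          by (cases zs rule: rev_cases) (auto simp: mf_histories_def)
        with * False that show False by (auto simp: snoc_history_iff fibre_def)
      qed
    qed (use Suc in auto)
    from this[of x] this[OF empirical_composed[OF \<sigma>]] show ?thesis by (simp add: o_def)
  qed
qed

lemma visits_prob_cong:
  assumes "d \<in> coord_strategies M" "1 \<le> t" "t \<le> Suc (horizon M)" "x \<in> fibre M z" "y \<in> fibre M z"
  shows "prob (visits M d t x zs) = prob (visits M d t y zs)"
proof -
  have xy: "x \<in> state_profiles M" "y \<in> state_profiles M" "empirical M x = empirical M y"
    using assms by (auto simp: fibre_def)
  obtain \<sigma> where "type_symmetry M \<sigma>" "x = y \<circ> \<sigma>" by (rule empirical_eqD[OF xy])
  then show ?thesis using visits_prob_composed[OF assms(1) _ assms(2,3) xy(2)] by simp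
qed

end

section \<open>Conditional expectations given the mean-field history\<close>

definition history_prob ::
  "('x, 'u, 'w, 'a) mft \<Rightarrow> ('x, 'u) coord_strategy \<Rightarrow> nat \<Rightarrow> 'x mean_field list \<Rightarrow> real" where
  "history_prob M d t zs =
    measure (base M) {\<omega> \<in> space (base M). snd (trajectory M d \<omega> t) = zs}"

definition fibre_mean :: "('x, 'u, 'w, 'a) mft \<Rightarrow> 'x mean_field \<Rightarrow> ((nat \<Rightarrow> 'x) \<Rightarrow> real) \<Rightarrow> real" where
  "fibre_mean M z F = (\<Sum>x\<in>fibre M z. F x) / card (fibre M z)"

text \<open>
  The fibre averages \<open>mean_cost\<close> and \<open>mean_next\<close> are candidates for the conditional expected cost
  and the conditional expectation of \<open>h\<close> at the next mean-field, defined without reference to any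
  strategy.
\<close>

definition mean_cost ::
  "('x, 'u, 'w, 'a) mft \<Rightarrow> nat \<Rightarrow> 'x mean_field \<Rightarrow> ('x, 'u) prescription \<Rightarrow> real" where
  "mean_cost M t z \<gamma> = fibre_mean M z (\<lambda>x. cost M t x (actions_of M \<gamma> x))"

definition mean_next ::
  "('x, 'u, 'w, 'a) mft \<Rightarrow> nat \<Rightarrow> 'x mean_field \<Rightarrow> ('x, 'u) prescription \<Rightarrow>
    ('x mean_field \<Rightarrow> real) \<Rightarrow> real" where
  "mean_next M t z \<gamma> h = fibre_mean M z
    (\<lambda>x. \<Sum>y\<in>state_profiles M. transition_prob M t \<gamma> x y * h (empirical M y))"

text \<open>
  All expectations in the model are finite sums, since profiles and histories take
  finitely many values.
\<close>

lemma (in prob_space) finite_range_expectation: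
  fixes F :: "'b \<Rightarrow> real"
  assumes S: "finite S" and range: "\<And>\<omega>. \<omega> \<in> space M \<Longrightarrow> X \<omega> \<in> S"
    and ev: "\<And>s. s \<in> S \<Longrightarrow> {\<omega> \<in> space M. X \<omega> = s} \<in> events"
  shows "integrable M (\<lambda>\<omega>. F (X \<omega>))"
    and "(LINT \<omega>|M. F (X \<omega>)) = (\<Sum>s\<in>S. prob {\<omega> \<in> space M. X \<omega> = s} * F s)"
proof -
  let ?g = "\<lambda>\<omega>. \<Sum>s\<in>S. indicator {\<omega> \<in> space M. X \<omega> = s} \<omega> * F s"
  have eq: "F (X \<omega>) = ?g \<omega>" if "\<omega> \<in> space M" for \<omega>
  proof -
    have "?g \<omega> = (\<Sum>s\<in>S. if s = X \<omega> then F s else 0)"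
      using that by (intro sum.cong) (auto simp: indicator_def)
    then show ?thesis using S range[OF that] by (simp add: sum.delta')
  qed
  have int: "integrable M (\<lambda>\<omega>. indicator {\<omega> \<in> space M. X \<omega> = s} \<omega> * F s)" if "s \<in> S" for s
    using ev[OF that] by (intro integrable_mult_left) (simp add: less_top[symmetric])
  have "integrable M ?g" by (rule Bochner_Integration.integrable_sum[OF int])
  then show "integrable M (\<lambda>\<omega>. F (X \<omega>))" 
    by (subst Bochner_Integration.integrable_cong[OF refl eq])
  have "(LINT \<omega>|M. F (X \<omega>)) = (LINT \<omega>|M. ?g \<omega>)" using eq by (intro Bochner_Integration.integral_cong) auto
  also have "\<dots> = (\<Sum>s\<in>S. LINT \<omega>|M. indicator {\<omega> \<in> space M. X \<omega> = s} \<omega> * F s)"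
    by (rule Bochner_Integration.integral_sum[OF int])
  also have "\<dots> = (\<Sum>s\<in>S. prob {\<omega> \<in> space M. X \<omega> = s} * F s)"
    using ev by (intro sum.cong refl) (simp add: Int_absorb1)
  finally show "(LINT \<omega>|M. F (X \<omega>)) = (\<Sum>s\<in>S. prob {\<omega> \<in> space M. X \<omega> = s} * F s)" .
qed

context mft_model
begin

context
  fixes d t
  assumes d: "d \<in> coord_strategies M" and t: "1 \<le> t" "t \<le> Suc (horizon M)"
begin

lemma history_prob_eq_sum:
  assumes "zs \<in> mf_histories M t"
  shows "history_prob M d t zs = (\<Sum>x\<in>fibre M (last zs). prob (visits M d t x zs))"
proof -
  have "{\<omega> \<in> space (base M). snd (trajectory M d \<omega> t) = zs} =
      (\<Union>x\<in>fibre M (last zs). visits M d t x zs)"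
    using trajectory_range[OF d _ t] by (force simp: visits_def fibre_def prod_eq_iff)
  moreover have "prob (\<Union>x\<in>fibre M (last zs). visits M d t x zs) =
      (\<Sum>x\<in>fibre M (last zs). prob (visits M d t x zs))"
    by (rule finite_measure_finite_Union[OF finite_fibre])
      (auto simp: disjoint_family_on_def visits_def intro!: visits_event[OF d t, unfolded visits_def])
  ultimately show ?thesis by (simp add: history_prob_def)
qed

text \<open>
  By exchangeability all profiles in the fibre of the current mean-field are equally likely given the
  history.  The mean-field is thus all that the coordinator's observations reveal about
  the state profile.
\<close>

lemma visits_prob_uniform:
  assumes zs: "zs \<in> mf_histories M t" and x: "x \<in> fibre M (last zs)"
  shows "prob (visits M d t x zs) = history_prob M d t zs / card (fibre M (last zs))"
proof -
  have "history_prob M d t zs = (\<Sum>y\<in>fibre M (last zs). prob (visits M d t x zs))"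
    unfolding history_prob_eq_sum[OF zs]
    by (intro sum.cong refl visits_prob_cong[OF d t _ x])
  moreover have "card (fibre M (last zs)) \<noteq> 0" using x finite_fibre by auto
  ultimately show ?thesis by simp
qed

lemma sum_visits_prob:
  "(\<Sum>(x, zs)\<in>state_profiles M \<times> mf_histories M t. prob (visits M d t x zs) * F x zs) =
    (\<Sum>zs\<in>mf_histories M t. history_prob M d t zs * fibre_mean M (last zs) (\<lambda>x. F x zs))"
proof -
  have "(\<Sum>(x, zs)\<in>state_profiles M \<times> mf_histories M t. prob (visits M d t x zs) * F x zs) =
      (\<Sum>zs\<in>mf_histories M t. \<Sum>x\<in>state_profiles M. prob (visits M d t x zs) * F x zs)"
    unfolding sum.cartesian_product[symmetric] by (rule sum.swap)
  also have "\<dots> = (\<Sum>zs\<in>mf_histories M t. \<Sum>x\<in>fibre M (last zs). prob (visits M d t x zs) * F x zs)"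
    using visits_empty[OF d t] finite_state_profiles
    by (intro sum.cong refl sum.mono_neutral_right) (auto simp: fibre_def)
  also have "\<dots> = (\<Sum>zs\<in>mf_histories M t. history_prob M d t zs * fibre_mean M (last zs) (\<lambda>x. F x zs))"
    by (intro sum.cong refl)
      (simp add: visits_prob_uniform fibre_mean_def sum_distrib_left sum_divide_distrib)
  finally show ?thesis .
qed

lemma trajectory_expectation:
  fixes F :: "(nat \<Rightarrow> 'x) \<Rightarrow> 'x mean_field list \<Rightarrow> real"
  shows "integrable (base M) (\<lambda>\<omega>. F (fst (trajectory M d \<omega> t)) (snd (trajectory M d \<omega> t)))"
    and "(LINT \<omega>|base M. F (fst (trajectory M d \<omega> t)) (snd (trajectory M d \<omega> t))) =
      (\<Sum>zs\<in>mf_histories M t. history_prob M d t zs * fibre_mean M (last zs) (\<lambda>x. F x zs))"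
proof -
  let ?S = "state_profiles M \<times> mf_histories M t"
  have S: "finite ?S" "\<And>\<omega>. \<omega> \<in> space (base M) \<Longrightarrow> trajectory M d \<omega> t \<in> ?S"
    "\<And>s. s \<in> ?S \<Longrightarrow> {\<omega> \<in> space (base M). trajectory M d \<omega> t = s} \<in> events"
    using finite_state_profiles finite_mf_histories trajectory_range[OF d _ t] visits_event[OF d t]
    by (auto simp: visits_def mem_Times_iff)
  show "integrable (base M) (\<lambda>\<omega>. F (fst (trajectory M d \<omega> t)) (snd (trajectory M d \<omega> t)))"
    by (rule finite_range_expectation(1)[OF S, where F = "\<lambda>s. F (fst s) (snd s)"])
  have "(LINT \<omega>|base M. F (fst (trajectory M d \<omega> t)) (snd (trajectory M d \<omega> t))) =
      (\<Sum>(x, zs)\<in>?S. prob (visits M d t x zs) * F x zs)"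
    unfolding visits_def
    by (subst finite_range_expectation(2)[OF S, where F = "\<lambda>s. F (fst s) (snd s)"])
      (auto intro: sum.cong)
  then show "(LINT \<omega>|base M. F (fst (trajectory M d \<omega> t)) (snd (trajectory M d \<omega> t))) =
      (\<Sum>zs\<in>mf_histories M t. history_prob M d t zs * fibre_mean M (last zs) (\<lambda>x. F x zs))"
    unfolding sum_visits_prob .
qed

lemma history_expectation:
  "(LINT \<omega>|base M. G (snd (trajectory M d \<omega> t))) =
    (\<Sum>zs\<in>mf_histories M t. history_prob M d t zs * (G zs :: real))"
proof -
  have "card (fibre M (last zs)) \<noteq> 0" if "zs \<in> mf_histories M t" for zs
    using last_history_in[OF that t(1)] finite_fibre by (auto simp: mean_fields_def fibre_def)
  then show ?thesis
    by (subst trajectory_expectation(2)[where F = "\<lambda>_. G"])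
      (auto intro!: sum.cong simp: fibre_mean_def)
qed

lemma history_prob_nonneg: "0 \<le> history_prob M d t zs"
  by (simp add: history_prob_def)

end

context
  fixes d t
  assumes d: "d \<in> coord_strategies M" and t: "t \<in> {1..horizon M}"
begin

text \<open>
  In this lemma and in \<open>next_expectation\<close> the weight \<open>G\<close> is an arbitrary function of the history.
  Taking it constant gives total expectations; taking the indicator of \<open>info_event\<close> gives the
  conditional ones.
\<close>

lemma cost_expectation:
  "(LINT \<omega>|base M. G (snd (trajectory M d \<omega> t)) * cost M t (state_at M d t \<omega>) (action_at M d t \<omega>)) =
    (\<Sum>zs\<in>mf_histories M t. history_prob M d t zs * (G zs * mean_cost M t (last zs) (d t zs)))"
  unfolding state_at_def action_at_def prescription_at_def
  using t by (subst trajectory_expectation(2)[OF d,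
      where F = "\<lambda>x zs. G zs * cost M t x (actions_of M (d t zs) x)"])
    (auto simp: mean_cost_def fibre_mean_def sum_distrib_left)

lemma integrable_cost:
  "integrable (base M) (\<lambda>\<omega>. cost M t (state_at M d t \<omega>) (action_at M d t \<omega>))"
  unfolding state_at_def action_at_def prescription_at_def
  using t by (intro trajectory_expectation(1)[OF d,
      where F = "\<lambda>x zs. cost M t x (actions_of M (d t zs) x)"]) auto

lemma next_expectation:
  "(LINT \<omega>|base M. G (snd (trajectory M d \<omega> t)) * h (mf_at M d (Suc t) \<omega>)) =
    (\<Sum>zs\<in>mf_histories M t. history_prob M d t zs * (G zs * mean_next M t (last zs) (d t zs) h))"
proof -
  let ?S = "(state_profiles M \<times> mf_histories M t) \<times> state_profiles M"
  let ?X = "\<lambda>\<omega>. (trajectory M d \<omega> t, state_at M d (Suc t) \<omega>)"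
  have S: "finite ?S" using finite_state_profiles finite_mf_histories by blast
  have range: "?X \<omega> \<in> ?S" if "\<omega> \<in> space (base M)" for \<omega>
    using trajectory_range[OF d that, of t] trajectory_range[OF d that, of "Suc t"] t
    by (auto simp: mem_Times_iff state_at_def)
  have ev: "{\<omega> \<in> space (base M). ?X \<omega> = s} \<in> events" if "s \<in> ?S" for s
    using step_event_in_events[OF d t, of "snd s" "fst (fst s)" "snd (fst s)"] that
    by (auto simp: prod_eq_iff)
  \<comment> \<open>Expand over the joint values of the trajectory at \<open>t\<close> and the next profile, then factorise.\<close>
  have "(LINT \<omega>|base M. G (snd (trajectory M d \<omega> t)) * h (mf_at M d (Suc t) \<omega>)) =
      (\<Sum>s\<in>?S. prob {\<omega> \<in> space (base M). ?X \<omega> = s} * (G (snd (fst s)) * h (empirical M (snd s))))"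
    unfolding mf_at_def
    using finite_range_expectation(2)[OF S range ev,
        where F = "\<lambda>s. G (snd (fst s)) * h (empirical M (snd s))"] by simp
  also have "\<dots> = (\<Sum>s\<in>?S. prob (visits M d t (fst (fst s)) (snd (fst s))) *
      transition_prob M t (d t (snd (fst s))) (fst (fst s)) (snd s) *
      (G (snd (fst s)) * h (empirical M (snd s))))"
    using step_prob[OF d t] by (intro sum.cong) auto
  also have "\<dots> = (\<Sum>(x, zs)\<in>state_profiles M \<times> mf_histories M t. prob (visits M d t x zs) *
      (G zs * (\<Sum>y\<in>state_profiles M. transition_prob M t (d t zs) x y * h (empirical M y))))"
    by (subst sum.cartesian_product')
      (auto intro!: sum.cong simp: sum_distrib_left mult_ac)
  also have "\<dots> = (\<Sum>zs\<in>mf_histories M t.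
      history_prob M d t zs * (G zs * mean_next M t (last zs) (d t zs) h))"
    using t by (subst sum_visits_prob[OF d])
      (auto simp: mean_next_def fibre_mean_def sum_distrib_left)
  finally show ?thesis .
qed

lemma indicator_info_event:
  assumes "\<omega> \<in> space (base M)"
  shows "indicator (info_event M d t z \<gamma>) \<omega> =
    (of_bool (last (snd (trajectory M d \<omega> t)) = z \<and> d t (snd (trajectory M d \<omega> t)) = \<gamma>) :: real)"
  using trajectory_range[OF d assms, of t] t assms
  by (auto simp: indicator_def info_event_def mf_at_def state_at_def prescription_at_def)

lemma info_event_in_events: "info_event M d t z \<gamma> \<in> events"
proof -
  have "info_event M d t z \<gamma> = (\<Union>s\<in>state_profiles M \<times> mf_histories M t.
      if empirical M (fst s) = z \<and> d t (snd s) = \<gamma> then visits M d t (fst s) (snd s) else {})"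
    using trajectory_range[OF d, of _ t] t
    by (force simp: info_event_def mf_at_def state_at_def prescription_at_def visits_def prod_eq_iff
        split: if_splits)
  then show ?thesis
    using finite_state_profiles finite_mf_histories visits_event[OF d, of t] t by auto
qed

lemma info_event_prob:
  "prob (info_event M d t z \<gamma>) =
    (\<Sum>zs\<in>mf_histories M t. history_prob M d t zs * of_bool (last zs = z \<and> d t zs = \<gamma>))"
proof -
  have "prob (info_event M d t z \<gamma>) = (LINT \<omega>|base M. indicator (info_event M d t z \<gamma>) \<omega>)"
    using info_event_in_events sets.sets_into_space[OF info_event_in_events] by (simp add: Int_absorb1)
  also have "\<dots> = (LINT \<omega>|base M.
      of_bool (last (snd (trajectory M d \<omega> t)) = z \<and> d t (snd (trajectory M d \<omega> t)) = \<gamma>))"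
    by (intro Bochner_Integration.integral_cong refl indicator_info_event)
  also have "\<dots> = (\<Sum>zs\<in>mf_histories M t.
      history_prob M d t zs * of_bool (last zs = z \<and> d t zs = \<gamma>))"
    using t by (intro history_expectation[OF d]) auto
  finally show ?thesis .
qed

text \<open>
  The right-hand side does not mention the strategy: the conditional cost is well defined.
\<close>

lemma conditional_cost_eq:
  assumes "prob (info_event M d t z \<gamma>) > 0"
  shows "(LINT \<omega>:info_event M d t z \<gamma>|base M. cost M t (state_at M d t \<omega>) (action_at M d t \<omega>)) /
    prob (info_event M d t z \<gamma>) = mean_cost M t z \<gamma>"
proof -
  let ?G = "\<lambda>zs. of_bool (last zs = z \<and> d t zs = \<gamma>) :: real"
  have "(LINT \<omega>:info_event M d t z \<gamma>|base M. cost M t (state_at M d t \<omega>) (action_at M d t \<omega>)) =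
      (LINT \<omega>|base M. ?G (snd (trajectory M d \<omega> t)) *
        cost M t (state_at M d t \<omega>) (action_at M d t \<omega>))"
    unfolding set_lebesgue_integral_def
    by (intro Bochner_Integration.integral_cong refl) (simp add: indicator_info_event)
  also have "\<dots> = (\<Sum>zs\<in>mf_histories M t.
      history_prob M d t zs * (?G zs * mean_cost M t (last zs) (d t zs)))"
    by (rule cost_expectation)
  also have "\<dots> = prob (info_event M d t z \<gamma>) * mean_cost M t z \<gamma>"
    unfolding info_event_prob sum_distrib_right by (intro sum.cong refl) auto
  finally show ?thesis using assms by simp
qed

lemma conditional_law_eq:
  assumes "prob (info_event M d t z \<gamma>) > 0"
  shows "\<P>(\<omega> in base M. mf_at M d (Suc t) \<omega> = z' \<bar>
      mf_at M d t \<omega> = z \<and> prescription_at M d t \<omega> = \<gamma>) =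
    mean_next M t z \<gamma> (\<lambda>z''. of_bool (z'' = z'))"
proof -
  let ?G = "\<lambda>zs. of_bool (last zs = z \<and> d t zs = \<gamma>) :: real"
  let ?A = "{\<omega> \<in> space (base M). mf_at M d (Suc t) \<omega> = z' \<and>
      mf_at M d t \<omega> = z \<and> prescription_at M d t \<omega> = \<gamma>}"
  have "{\<omega> \<in> space (base M). mf_at M d (Suc t) \<omega> = z'} =
      (\<Union>s\<in>state_profiles M \<times> mf_histories M (Suc t).
        if empirical M (fst s) = z' then visits M d (Suc t) (fst s) (snd s) else {})"
    using trajectory_range[OF d, of _ "Suc t"] t
    by (force simp: mf_at_def state_at_def visits_def prod_eq_iff split: if_splits)
  also have "\<dots> \<in> events"
    using finite_state_profiles finite_mf_histories visits_event[OF d, of "Suc t"] t by auto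
  moreover have "?A = {\<omega> \<in> space (base M). mf_at M d (Suc t) \<omega> = z'} \<inter> info_event M d t z \<gamma>"
    by (auto simp: info_event_def)
  ultimately have "?A \<in> events" using info_event_in_events by auto
  then have "prob ?A = (LINT \<omega>|base M. indicator ?A \<omega>)"
    by (simp add: Int_absorb1 sets.sets_into_space)
  also have "\<dots> = (LINT \<omega>|base M. ?G (snd (trajectory M d \<omega> t)) * of_bool (mf_at M d (Suc t) \<omega> = z'))"
    by (intro Bochner_Integration.integral_cong refl)
      (simp add: indicator_info_event[symmetric], simp add: indicator_def info_event_def)
  also have "\<dots> = (\<Sum>zs\<in>mf_histories M t. history_prob M d t zs *
      (?G zs * mean_next M t (last zs) (d t zs) (\<lambda>z''. of_bool (z'' = z'))))"
    by (rule next_expectation)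
  also have "\<dots> = prob (info_event M d t z \<gamma>) * mean_next M t z \<gamma> (\<lambda>z''. of_bool (z'' = z'))"
    unfolding info_event_prob sum_distrib_right by (intro sum.cong refl) auto
  finally show ?thesis using assms by (simp add: cond_prob_def info_event_def)
qed

text \<open>
  A strategy reaches the pairs that occur along its own histories, so the unspecified values of the
  conditional cost and law at unreached pairs never contribute to its expected cost.
\<close>

lemma history_reaching:
  assumes "history_prob M d t zs > 0" "zs \<in> mf_histories M t"
  shows "d \<in> reaching M t (last zs) (d t zs)"
proof -
  have "{\<omega> \<in> space (base M). snd (trajectory M d \<omega> t) = zs} \<subseteq> info_event M d t (last zs) (d t zs)"
    using trajectory_range[OF d, of _ t] t
    by (auto simp: info_event_def mf_at_def state_at_def prescription_at_def)
  then have "history_prob M d t zs \<le> prob (info_event M d t (last zs) (d t zs))"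
    unfolding history_prob_def by (rule finite_measure_mono[OF _ info_event_in_events])
  then show ?thesis using assms d by (simp add: reaching_def)
qed

end

text \<open>
  The conditional law is given by point probabilities; this recovers all expectations from them.
\<close>

lemma mean_next_linear:
  "mean_next M t z \<gamma> h =
    (\<Sum>z'\<in>mean_fields M. mean_next M t z \<gamma> (\<lambda>z''. of_bool (z'' = z')) * h z')"
proof -
  have "(\<Sum>z'\<in>mean_fields M. (\<Sum>y\<in>state_profiles M.
        transition_prob M t \<gamma> x y * of_bool (empirical M y = z')) * h z') =
      (\<Sum>y\<in>state_profiles M. transition_prob M t \<gamma> x y * h (empirical M y))" for x
  proof -
    have "(\<Sum>z'\<in>mean_fields M. (\<Sum>y\<in>state_profiles M.
        transition_prob M t \<gamma> x y * of_bool (empirical M y = z')) * h z') =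
      (\<Sum>y\<in>state_profiles M. \<Sum>z'\<in>mean_fields M.
        if z' = empirical M y then transition_prob M t \<gamma> x y * h z' else 0)"
      unfolding sum_distrib_right by (subst sum.swap) (auto intro!: sum.cong)
    then show ?thesis using finite_mean_fields empirical_in by (simp add: sum.delta)
  qed
  note sw = this
  show ?thesis
    unfolding mean_next_def fibre_mean_def times_divide_eq_left sum_divide_distrib[symmetric]
    unfolding sum_distrib_right[of _ "fibre M z"] 
    by (subst sum.swap) (simp add: sw)
qed

end

section \<open>Verification of the dynamic program\<close>

text \<open>
  The expression minimised in the dynamic program.
\<close>

definition q_value ::
  "('x, 'u, 'w, 'a) mft \<Rightarrow> (nat \<Rightarrow> 'x mean_field \<Rightarrow> ('x, 'u) prescription \<Rightarrow> real) \<Rightarrow>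
    (nat \<Rightarrow> 'x mean_field \<Rightarrow> ('x, 'u) prescription \<Rightarrow> 'x mean_field pmf) \<Rightarrow>
    nat \<Rightarrow> 'x mean_field \<Rightarrow> ('x, 'u) prescription \<Rightarrow> real" where
  "q_value M L Q t z \<gamma> =
    L t z \<gamma> + measure_pmf.expectation (Q t z \<gamma>) (value_fn M L Q (Suc t))"

definition coordination_cost :: "('x, 'u, 'w, 'a) mft \<Rightarrow> ('x, 'u) coord_strategy \<Rightarrow> real" where
  "coordination_cost M d = (LINT \<omega>|base M. (\<Sum>t=1..horizon M.
      cost M t (state_at M d t \<omega>) (action_at M d t \<omega>)))"

text \<open>
  The expected value function at the first mean-field.  No strategy enters, because no action is
  taken before the first mean-field.
\<close>

definition initial_value :: "('x, 'u, 'w, 'a) mft \<Rightarrow>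
    (nat \<Rightarrow> 'x mean_field \<Rightarrow> ('x, 'u) prescription \<Rightarrow> real) \<Rightarrow>
    (nat \<Rightarrow> 'x mean_field \<Rightarrow> ('x, 'u) prescription \<Rightarrow> 'x mean_field pmf) \<Rightarrow> real" where
  "initial_value M L Q = (LINT \<omega>|base M.
    value_fn M L Q 1 (empirical M (\<lambda>i\<in>{1..nsub M}. init M i \<omega>)))"

text \<open>
  The restriction makes the decision rule extensional, as prescriptions are required to be.
\<close>

definition coordination_of :: "('x, 'u, 'w, 'a) mft \<Rightarrow> ('x, 'u) strategy \<Rightarrow> ('x, 'u) coord_strategy" where
  "coordination_of M g = (\<lambda>t zs. restrict (decision_rule g t zs) (SIGMA \<theta>:{1..ntyp M}. state_set M \<theta>))"

context mft_model
begin

lemma value_fn_terminal: "horizon M < t \<Longrightarrow> value_fn M L Q t z = 0"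
  by (simp add: value_fn.simps)

lemma value_fn_eq_Min:
  "t \<le> horizon M \<Longrightarrow> value_fn M L Q t z = Min (q_value M L Q t z ` prescriptions M)"
  by (subst value_fn.simps) (simp add: q_value_def)

lemma value_fn_le:
  "t \<le> horizon M \<Longrightarrow> \<gamma> \<in> prescriptions M \<Longrightarrow> value_fn M L Q t z \<le> q_value M L Q t z \<gamma>"
  using finite_prescriptions by (simp add: value_fn_eq_Min)

lemma dp_solution_iff:
  "dp_solution M L Q \<psi> \<longleftrightarrow> (\<forall>t\<in>{1..horizon M}. \<forall>z\<in>mean_fields M.
    \<psi> t z \<in> prescriptions M \<and> q_value M L Q t z (\<psi> t z) = value_fn M L Q t z)"
proof -
  have "is_arg_min (q_value M L Q t z) (\<lambda>\<gamma>. \<gamma> \<in> prescriptions M) \<gamma> \<longleftrightarrow>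
      \<gamma> \<in> prescriptions M \<and> q_value M L Q t z \<gamma> = value_fn M L Q t z" if "t \<le> horizon M" for t z \<gamma>
    using finite_prescriptions prescriptions_nonempty
    by (auto simp: is_arg_min_linorder value_fn_eq_Min[OF that] intro!: Min_eqI[symmetric])
  then show ?thesis unfolding dp_solution_def q_value_def[symmetric] by simp
qed

lemma dp_solution_exists: "\<exists>\<psi>. dp_solution M L Q \<psi>"
proof -
  have "\<exists>\<gamma>. \<gamma> \<in> prescriptions M \<and> q_value M L Q t z \<gamma> = value_fn M L Q t z" if "t \<le> horizon M" for t z
  proof -
    have "value_fn M L Q t z \<in> q_value M L Q t z ` prescriptions M"
      unfolding value_fn_eq_Min[OF that]
      using finite_prescriptions prescriptions_nonempty by (intro Min_in) auto
    then show ?thesis by force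
  qed
  then have "\<forall>t z. \<exists>\<gamma>. t \<le> horizon M \<longrightarrow>
      \<gamma> \<in> prescriptions M \<and> q_value M L Q t z \<gamma> = value_fn M L Q t z" by blast
  then show ?thesis unfolding dp_solution_iff by (metis atLeastAtMost_iff)
qed

context
  fixes L Q
  assumes L: "is_conditional_cost M L" and Q: "is_conditional_law M Q"
begin

lemma reached_cost:
  assumes "t \<in> {1..horizon M}" "z \<in> mean_fields M" "\<gamma> \<in> prescriptions M" "reaching M t z \<gamma> \<noteq> {}"
  shows "L t z \<gamma> = mean_cost M t z \<gamma>"
proof -
  obtain \<psi> where "\<psi> \<in> reaching M t z \<gamma>" "L t z \<gamma> =
      (LINT \<omega>:info_event M \<psi> t z \<gamma>|base M. cost M t (state_at M \<psi> t \<omega>) (action_at M \<psi> t \<omega>))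
          / prob (info_event M \<psi> t z \<gamma>)"
    using L assms unfolding is_conditional_cost_def by blast
  then show ?thesis using conditional_cost_eq[of \<psi> t z \<gamma>] assms(1) by (simp add: reaching_def)
qed

lemma reached_expectation:
  assumes "t \<in> {1..horizon M}" "z \<in> mean_fields M" "\<gamma> \<in> prescriptions M" "reaching M t z \<gamma> \<noteq> {}"
  shows "measure_pmf.expectation (Q t z \<gamma>) h = mean_next M t z \<gamma> h"
proof -
  have sub: "set_pmf (Q t z \<gamma>) \<subseteq> mean_fields M"
    using Q assms(1-3) unfolding is_conditional_law_def by blast
  obtain \<psi> where \<psi>: "\<psi> \<in> reaching M t z \<gamma>" "\<forall>z'\<in>mean_fields M. pmf (Q t z \<gamma>) z' =
        \<P>(\<omega> in base M. mf_at M \<psi> (Suc t) \<omega> = z' \<bar>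
          mf_at M \<psi> t \<omega> = z \<and> prescription_at M \<psi> t \<omega> = \<gamma>)"
    using Q assms unfolding is_conditional_law_def by blast
  have "measure_pmf.expectation (Q t z \<gamma>) h = (\<Sum>z'\<in>mean_fields M. pmf (Q t z \<gamma>) z' * h z')"
    using sub by (subst integral_measure_pmf[OF finite_mean_fields]) auto
  also have "\<dots> = mean_next M t z \<gamma> h"
    unfolding mean_next_linear[of t z \<gamma> h]
    using \<psi> conditional_law_eq[of \<psi> t z \<gamma>] assms(1) by (intro sum.cong) (simp_all add: reaching_def)
  finally show ?thesis .
qed

text \<open>
  Where the history has positive probability, the strategy \<open>d\<close> reaches the current pair itself, so
  \<open>L\<close> and \<open>Q\<close> have their true values; all other histories have weight zero.
\<close>

lemma bellman_step:
  assumes d: "d \<in> coord_strategies M" and t: "t \<in> {1..horizon M}"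
  shows "(LINT \<omega>|base M. cost M t (state_at M d t \<omega>) (action_at M d t \<omega>)) +
      (LINT \<omega>|base M. value_fn M L Q (Suc t) (mf_at M d (Suc t) \<omega>)) =
    (\<Sum>zs\<in>mf_histories M t. history_prob M d t zs * q_value M L Q t (last zs) (d t zs))"
proof -
  let ?V = "value_fn M L Q (Suc t)"
  have "(LINT \<omega>|base M. cost M t (state_at M d t \<omega>) (action_at M d t \<omega>)) +
      (LINT \<omega>|base M. ?V (mf_at M d (Suc t) \<omega>)) =
    (\<Sum>zs\<in>mf_histories M t. history_prob M d t zs *
      (mean_cost M t (last zs) (d t zs) + mean_next M t (last zs) (d t zs) ?V))"
    using cost_expectation[OF d t, of "\<lambda>_. 1"] next_expectation[OF d t, of "\<lambda>_. 1" ?V]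
    by (simp add: sum.distrib distrib_left)
  also have "\<dots> = (\<Sum>zs\<in>mf_histories M t. history_prob M d t zs * q_value M L Q t (last zs) (d t zs))"
  proof (intro sum.cong refl)
    fix zs assume zs: "zs \<in> mf_histories M t"
    show "history_prob M d t zs *
        (mean_cost M t (last zs) (d t zs) + mean_next M t (last zs) (d t zs) ?V) =
      history_prob M d t zs * q_value M L Q t (last zs) (d t zs)"
    proof (cases "history_prob M d t zs > 0")
      case True
      have "last zs \<in> mean_fields M" using last_history_in[OF zs] t by simp
      note r = t this coord_strategiesD[OF d t zs]
      have "reaching M t (last zs) (d t zs) \<noteq> {}" using history_reaching[OF d t True zs] by blast
      then show ?thesis using reached_cost[OF r] reached_expectation[OF r] by (simp add: q_value_def)
    next
      case False
      then have "history_prob M d t zs = 0" using history_prob_nonneg[OF d, of t zs] t by simp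
      then show ?thesis by simp
    qed
  qed
  finally show ?thesis .
qed

lemma value_expectation:
  assumes d: "d \<in> coord_strategies M" and t: "1 \<le> t" "t \<le> Suc (horizon M)"
  shows "(LINT \<omega>|base M. value_fn M L Q t (mf_at M d t \<omega>)) =
    (\<Sum>zs\<in>mf_histories M t. history_prob M d t zs * value_fn M L Q t (last zs))"
proof -
  have "(LINT \<omega>|base M. value_fn M L Q t (mf_at M d t \<omega>)) =
      (LINT \<omega>|base M. value_fn M L Q t (last (snd (trajectory M d \<omega> t))))"
    using trajectory_range[OF d _ t]
    by (intro Bochner_Integration.integral_cong) (auto simp: mf_at_def state_at_def)
  then show ?thesis using history_expectation[OF d t, of "\<lambda>zs. value_fn M L Q t (last zs)"] by simp
qed

text \<open>
  A performance-difference identity: the cost of a strategy is the initial value plus the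
  expected Bellman gaps of its prescriptions.  It is the sum over time of \<open>bellman_step\<close> minus the
  expected current value, with value zero after the horizon.
\<close>

lemma coordination_cost_telescope:
  assumes d: "d \<in> coord_strategies M"
  shows "coordination_cost M d = initial_value M L Q + (\<Sum>t=1..horizon M. \<Sum>zs\<in>mf_histories M t.
    history_prob M d t zs * (q_value M L Q t (last zs) (d t zs) - value_fn M L Q t (last zs)))"
proof -
  let ?c = "\<lambda>t. LINT \<omega>|base M. cost M t (state_at M d t \<omega>) (action_at M d t \<omega>)"
  let ?v = "\<lambda>t. LINT \<omega>|base M. value_fn M L Q t (mf_at M d t \<omega>)"
  have "(\<Sum>t=1..horizon M. \<Sum>zs\<in>mf_histories M t.
      history_prob M d t zs * (q_value M L Q t (last zs) (d t zs) - value_fn M L Q t (last zs))) =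
    (\<Sum>t=1..horizon M. ?c t - (?v t - ?v (Suc t)))"
    using bellman_step[OF d] value_expectation[OF d]
    by (intro sum.cong refl) (simp add: right_diff_distrib sum_subtractf algebra_simps)
  also have "\<dots> = (\<Sum>t=1..horizon M. ?c t) - (?v 1 - ?v (Suc (horizon M)))"
    using sum_natinterval_diff[of ?v 1 "horizon M"]
    by (cases "1 \<le> horizon M") (simp_all add: sum_subtractf not_le)
  also have "?v (Suc (horizon M)) = 0" by (simp add: value_fn_terminal)
  also have "?v 1 = initial_value M L Q"
    unfolding initial_value_def mf_at_def state_at_def trajectory_1 Let_def by simp
  also have "(\<Sum>t=1..horizon M. ?c t) = coordination_cost M d"
    unfolding coordination_cost_def
    by (intro Bochner_Integration.integral_sum[symmetric] integrable_cost[OF d])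
  finally show ?thesis by simp
qed

lemma coordination_cost_ge:
  assumes d: "d \<in> coord_strategies M"
  shows "initial_value M L Q \<le> coordination_cost M d"
  unfolding coordination_cost_telescope[OF d]
  using history_prob_nonneg[OF d] value_fn_le coord_strategiesD[OF d]
  by (auto intro!: sum_nonneg mult_nonneg_nonneg)

lemma coordination_cost_dp:
  assumes d: "d \<in> coord_strategies M" and \<psi>: "dp_solution M L Q \<psi>"
    and eq: "\<And>t zs. t \<in> {1..horizon M} \<Longrightarrow> zs \<in> mf_histories M t \<Longrightarrow> d t zs = \<psi> t (last zs)"
  shows "coordination_cost M d = initial_value M L Q"
  unfolding coordination_cost_telescope[OF d]
  using \<psi> eq last_history_in by (auto intro!: sum.neutral simp: dp_solution_iff)

end

lemma coordination_of_coord: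
  assumes "g \<in> strategies M"
  shows "coordination_of M g \<in> coord_strategies M"
  using assms
  by (auto simp: coord_strategies_def strategies_def coordination_of_def prescriptions_def decision_rule_def)

lemma actions_of_coordination_of:
  assumes "x \<in> state_profiles M"
  shows "actions_of M (coordination_of M g t zs) x = actions_of M (decision_rule g t zs) x"
  unfolding actions_of_def coordination_of_def
  using state_profilesD[OF assms] types by (intro restrict_ext) simp

lemma trajectory_coordination_of:
  assumes g: "g \<in> strategies M" and \<omega>: "\<omega> \<in> space (base M)"
  shows "1 \<le> t \<Longrightarrow> t \<le> Suc (horizon M) \<Longrightarrow>
    trajectory M (coordination_of M g) \<omega> t = trajectory M (decision_rule g) \<omega> t"
proof (induction t rule: nat_induct_at_least)
  case base
  then show ?case by simp
next
  case (Suc t)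
  then obtain s where s: "t = Suc s" by (cases t) auto
  have "fst (trajectory M (coordination_of M g) \<omega> t) \<in> state_profiles M"
    using trajectory_range[OF coordination_of_coord[OF g] \<omega>, of t] Suc by simp
  then show ?case using Suc actions_of_coordination_of[of _ g t]
    by (simp add: s split_beta Let_def)
qed

text \<open>
  Types and states that occur along a trajectory lie in the set to which \<open>coordination_of\<close>
  restricts the decision rule, so the actions are the same.  This transfers the lower bound
  from coordination strategies to control strategies.
\<close>

lemma expected_cost_eq_coordination_cost:
  assumes g: "g \<in> strategies M"
  shows "expected_cost M g = coordination_cost M (coordination_of M g)"
  unfolding expected_cost_def coordination_cost_def
proof (intro Bochner_Integration.integral_cong sum.cong refl)
  fix \<omega> t assume \<omega>: "\<omega> \<in> space (base M)" and t: "t \<in> {1..horizon M}"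
  have "trajectory M (decision_rule g) \<omega> t = trajectory M (coordination_of M g) \<omega> t"
    using trajectory_coordination_of[OF g \<omega>, of t] t by simp
  moreover have "fst (trajectory M (coordination_of M g) \<omega> t) \<in> state_profiles M"
    using trajectory_range[OF coordination_of_coord[OF g] \<omega>, of t] t by simp
  ultimately show "cost M t (state_at M (decision_rule g) t \<omega>) (action_at M (decision_rule g) t \<omega>) =
      cost M t (state_at M (coordination_of M g) t \<omega>) (action_at M (coordination_of M g) t \<omega>)"
    by (simp add: state_at_def action_at_def prescription_at_def actions_of_coordination_of)
qed

lemma induced_strategy_markov:
  assumes "dp_solution M L Q \<psi>"
  shows "induced_strategy \<psi> \<in> markov_strategies M"
proof -
  have "\<psi> t (last zs) (\<theta>, x) \<in> action_set M \<theta>"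
    if "t \<in> {1..horizon M}" "\<theta> \<in> {1..ntyp M}" "zs \<in> mf_histories M t" "x \<in> state_set M \<theta>" for t \<theta> zs x
  proof -
    have "\<psi> t (last zs) \<in> prescriptions M"
      using assms that last_history_in[OF that(3)] by (simp add: dp_solution_iff)
    then show ?thesis using that PiE_mem[of "\<psi> t (last zs)" _ _ "(\<theta>, x)"]
      unfolding prescriptions_def by fastforce
  qed
  then have "induced_strategy \<psi> \<in> strategies M" by (simp add: strategies_def induced_strategy_def)
  then show ?thesis unfolding markov_strategies_def
    by (auto simp: induced_strategy_def intro!: exI[of _ "\<lambda>t \<theta> z x. \<psi> t z (\<theta>, x)"])
qed

lemma coordination_of_induced:
  assumes "dp_solution M L Q \<psi>" "t \<in> {1..horizon M}" "zs \<in> mf_histories M t"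
  shows "coordination_of M (induced_strategy \<psi>) t zs = \<psi> t (last zs)"
proof -
  have "\<psi> t (last zs) \<in> prescriptions M"
    using assms last_history_in[OF assms(3)] by (simp add: dp_solution_iff)
  moreover have "decision_rule (induced_strategy \<psi>) t zs = \<psi> t (last zs)"
    by (auto simp: decision_rule_def induced_strategy_def)
  ultimately show ?thesis
    by (simp add: coordination_of_def prescriptions_def PiE_restrict)
qed

lemma induced_strategy_optimal:
  assumes L: "is_conditional_cost M L" and Q: "is_conditional_law M Q" and \<psi>: "dp_solution M L Q \<psi>"
  shows "optimal M (induced_strategy \<psi>)"
  unfolding optimal_def
proof (intro conjI ballI)
  show s: "induced_strategy \<psi> \<in> strategies M"
    using induced_strategy_markov[OF \<psi>] by (simp add: markov_strategies_def)
  fix g assume g: "g \<in> strategies M"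
  have "expected_cost M (induced_strategy \<psi>) = initial_value M L Q"
    unfolding expected_cost_eq_coordination_cost[OF s]
    by (rule coordination_cost_dp[OF L Q coordination_of_coord[OF s] \<psi> coordination_of_induced[OF \<psi>]])
  also have "\<dots> \<le> expected_cost M g"
    unfolding expected_cost_eq_coordination_cost[OF g]
    by (rule coordination_cost_ge[OF L Q coordination_of_coord[OF g]])
  finally show "expected_cost M (induced_strategy \<psi>) \<le> expected_cost M g" .
qed

end

theorem theorem2:
  fixes M :: "('x, 'u, 'w, 'a) mft"
    and L :: "nat \<Rightarrow> 'x mean_field \<Rightarrow> ('x, 'u) prescription \<Rightarrow> real"
    and Q :: "nat \<Rightarrow> 'x mean_field \<Rightarrow> ('x, 'u) prescription \<Rightarrow> 'x mean_field pmf"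
  assumes "mft_model M"
    and "is_conditional_cost M L"
    and "is_conditional_law M Q"
  shows "(\<forall>g\<in>strategies M. \<exists>h\<in>markov_strategies M. expected_cost M h \<le> expected_cost M g) \<and>
    (\<exists>\<psi>. dp_solution M L Q \<psi>) \<and>
    (\<forall>\<psi>. dp_solution M L Q \<psi> \<longrightarrow>
      induced_strategy \<psi> \<in> markov_strategies M \<and> optimal M (induced_strategy \<psi>))"
proof -
  interpret mft_model M by (rule assms(1))
  obtain \<psi> where "dp_solution M L Q \<psi>" using dp_solution_exists by blast
  then show ?thesis
    using induced_strategy_markov induced_strategy_optimal[OF assms(2,3)]
    unfolding optimal_def by blast
qed

end
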